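(* There are Hyp equivalence relations $E,F$ on $\mathscr N$, each satisfying $=_1\ \leq_H\ \cdot\ \leq_H\ =_2$, such that neither $E\leq_H F$ nor $F\leq_H E$.
   Context: $\mathscr N=\omega^\omega$. Hyp means lightface $\Delta^1_1$ (functions via their graphs). For equivalence relations $E,F$ on $\mathscr N$, $E\leq_H F$ means there is a Hyp function $f:\mathscr N\to\mathscr N$ with $xEy\iff f(x)Ff(y)$. $=_1$ is the equivalence relation on $\mathscr N$ with a single class; $=_2$ is the equivalence relation with $x\equiv y$ iff $x(0)=y(0)$ or both $x(0),y(0)\geq 1$. *)

theory Defs
  imports Main
begin

text \<open>
  Lightface classes on Baire space, defined through the two-sorted language of second-order
  arithmetic: number variables range over \<open>\<omega>\<close>, function variables over \<open>\<omega>\<^sup>\<omega>\<close>. Both sorts of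
  variables are named by natural numbers. There are no function constants, hence no real
  parameters: this is what makes the classes below lightface.
\<close>

type_synonym baire = "nat \<Rightarrow> nat"

datatype tm =
    NVar nat
  | Zero
  | Succ tm
  | Plus tm tm
  | Times tm tm
  | App nat tm

datatype fm =
    Eq tm tm
  | Neg fm
  | Conj fm fm
  | ExN nat fm
  | ExF nat fm

primrec tm_val :: "(nat \<Rightarrow> baire) \<Rightarrow> (nat \<Rightarrow> nat) \<Rightarrow> tm \<Rightarrow> nat" where
  "tm_val F v (NVar i) = v i"
| "tm_val F v Zero = 0"
| "tm_val F v (Succ t) = Suc (tm_val F v t)"
| "tm_val F v (Plus s t) = tm_val F v s + tm_val F v t"
| "tm_val F v (Times s t) = tm_val F v s * tm_val F v t"
| "tm_val F v (App i t) = F i (tm_val F v t)"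

primrec sat :: "(nat \<Rightarrow> baire) \<Rightarrow> (nat \<Rightarrow> nat) \<Rightarrow> fm \<Rightarrow> bool" where
  "sat F v (Eq s t) \<longleftrightarrow> tm_val F v s = tm_val F v t"
| "sat F v (Neg p) \<longleftrightarrow> \<not> sat F v p"
| "sat F v (Conj p q) \<longleftrightarrow> sat F v p \<and> sat F v q"
| "sat F v (ExN i p) \<longleftrightarrow> (\<exists>n. sat F (v(i := n)) p)"
| "sat F v (ExF i p) \<longleftrightarrow> (\<exists>g. sat (F(i := g)) v p)"

primrec arithmetical_fm :: "fm \<Rightarrow> bool" where
  "arithmetical_fm (Eq s t) \<longleftrightarrow> True"
| "arithmetical_fm (Neg p) \<longleftrightarrow> arithmetical_fm p"
| "arithmetical_fm (Conj p q) \<longleftrightarrow> arithmetical_fm p \<and> arithmetical_fm q"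
| "arithmetical_fm (ExN i p) \<longleftrightarrow> arithmetical_fm p"
| "arithmetical_fm (ExF i p) \<longleftrightarrow> False"

text \<open>
  \<open>\<Sigma>\<^sup>1\<^sub>1\<close> formulas: a block of existential function quantifiers in front of an arithmetical formula.
\<close>

inductive Sigma11_fm :: "fm \<Rightarrow> bool" where
  arith: "arithmetical_fm p \<Longrightarrow> Sigma11_fm p"
| ex: "Sigma11_fm p \<Longrightarrow> Sigma11_fm (ExF i p)"

text \<open>
  The subset of \<open>\<omega>\<^sup>\<omega> \<times> \<omega>\<^sup>\<omega>\<close> defined by a formula in its function variables 0 and 1. Any other free
  variable is read as 0 or as the constantly zero function; both are arithmetically definable,
  so this does not introduce parameters.
\<close>

definition defined_rel :: "fm \<Rightarrow> (baire \<times> baire) set" where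
  "defined_rel p = {(x, y). sat ((\<lambda>_ _. 0)(0 := x, 1 := y)) (\<lambda>_. 0) p}"

definition Sigma11 :: "(baire \<times> baire) set \<Rightarrow> bool" where
  "Sigma11 A \<longleftrightarrow> (\<exists>p. Sigma11_fm p \<and> A = defined_rel p)"

definition Pi11 :: "(baire \<times> baire) set \<Rightarrow> bool" where
  "Pi11 A \<longleftrightarrow> Sigma11 (- A)"

definition Hyp :: "(baire \<times> baire) set \<Rightarrow> bool" where
  "Hyp A \<longleftrightarrow> Sigma11 A \<and> Pi11 A"

definition Hyp_fun :: "(baire \<Rightarrow> baire) \<Rightarrow> bool" where
  "Hyp_fun f \<longleftrightarrow> Hyp {(x, y). f x = y}"

definition Hyp_reducible :: "(baire \<times> baire) set \<Rightarrow> (baire \<times> baire) set \<Rightarrow> bool"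
    (infix \<open>\<le>\<^sub>H\<close> 50) where
  "E \<le>\<^sub>H F \<longleftrightarrow> (\<exists>f. Hyp_fun f \<and> (\<forall>x y. (x, y) \<in> E \<longleftrightarrow> (f x, f y) \<in> F))"

definition eq1 :: "(baire \<times> baire) set" where
  "eq1 = UNIV"

definition eq2 :: "(baire \<times> baire) set" where
  "eq2 = {(x, y). x 0 = y 0 \<or> (x 0 \<ge> 1 \<and> y 0 \<ge> 1)}"

end

theory Submission
  imports Defs "HOL-Library.Nat_Bijection"
begin

text \<open>
  An equivalence relation whose two classes are a set and its complement reduces to another such
  relation only via a Hyp map between the distinguished sets, provided that these sets are nonempty
  and no Hyp function maps the second into the first. So it suffices to find nonempty Hyp sets \<open>A\<close>, \<open>B\<close>
  such that no Hyp function maps \<open>A\<close> into \<open>B\<close> or \<open>B\<close> into \<open>A\<close>.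

  Every \<open>\<Sigma>\<^sup>1\<^sub>1\<close> predicate of numbers says that some tree of a uniformly \<open>\<Delta>\<^sup>1\<^sub>1\<close> family has a branch;
  \<open>A\<close> and \<open>B\<close> are sets of branches of such trees. The existence of a Hyp map from \<open>A\<close> to \<open>B\<close> is a
  \<open>\<Pi>\<^sup>1\<^sub>1\<close> property of the indices, that is, the well-foundedness of a tree \<open>p\<close>; similarly a tree \<open>q\<close>
  belongs to maps from \<open>B\<close> to \<open>A\<close>. By diagonalisation the indices can be chosen such that \<open>A\<close> is nonempty
  iff the rank of \<open>p\<close> is at most that of \<open>q\<close>, and \<open>B\<close> is nonempty iff the rank of \<open>q\<close> is less than that of
  \<open>p\<close> or both trees are ill-founded. If one of the trees were well-founded, exactly one of the sets would be empty and
  the map given by the tree of smaller rank would go from the nonempty set into the empty one. Hence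
  both trees are ill-founded, both sets are nonempty, and there is no map in either direction.
\<close>

section \<open>Semantic closure properties of the lightface classes\<close>

text \<open>A semantic bound on the free variables; it supplies fresh indices for bound numbers and
  for blocks of quantified functions.\<close>

definition determined_below :: "nat \<Rightarrow> ((nat \<Rightarrow> baire) \<Rightarrow> (nat \<Rightarrow> nat) \<Rightarrow> 'a) \<Rightarrow> bool" where
  "determined_below N X \<longleftrightarrow>
     (\<forall>F F' v v'. (\<forall>i<N. F i = F' i \<and> v i = v' i) \<longrightarrow> X F v = X F' v')"

lemma determined_belowD:
  "determined_below N X \<Longrightarrow> (\<And>i. i < N \<Longrightarrow> F i = F' i \<and> v i = v' i) \<Longrightarrow> X F v = X F' v'"
  by (simp add: determined_below_def)

lemma determined_below_map2:
  assumes "determined_below M X" "determined_below N Y"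
  shows "determined_below (max M N) (\<lambda>F v. f (X F v) (Y F v))"
  unfolding determined_below_def
proof (intro allI impI)
  fix F F' :: "nat \<Rightarrow> baire" and v v' :: "nat \<Rightarrow> nat"
  assume *: "\<forall>i<max M N. F i = F' i \<and> v i = v' i"
  have "X F v = X F' v'" by (rule determined_belowD[OF assms(1)]) (use * in simp)
  moreover have "Y F v = Y F' v'" by (rule determined_belowD[OF assms(2)]) (use * in simp)
  ultimately show "f (X F v) (Y F v) = f (X F' v') (Y F' v')" by simp
qed

lemma tm_val_determined: "\<exists>N. determined_below N (\<lambda>F v. tm_val F v t)"
proof (induction t)
  case (Succ t)
  then obtain N where "determined_below N (\<lambda>F v. tm_val F v t)" ..
  from determined_below_map2[where f = "\<lambda>a _. Suc a", OF this this] show ?case by auto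
next
  case (NVar i)
  then show ?case by (intro exI[of _ "Suc i"]) (auto simp: determined_below_def)
next
  case (Plus s t)
  then obtain M N where "determined_below M (\<lambda>F v. tm_val F v s)" "determined_below N (\<lambda>F v. tm_val F v t)"
    by blast
  from determined_below_map2[where f = "(+)", OF this] show ?case by auto
next
  case (Times s t)
  then obtain M N where "determined_below M (\<lambda>F v. tm_val F v s)" "determined_below N (\<lambda>F v. tm_val F v t)"
    by blast
  from determined_below_map2[where f = "(*)", OF this] show ?case by auto
next
  case (App i t)
  then obtain N where "determined_below N (\<lambda>F v. tm_val F v t)" ..
  moreover have "determined_below (Suc i) (\<lambda>F v. F i)" by (simp add: determined_below_def)
  ultimately have "determined_below (max (Suc i) N) (\<lambda>F v. F i (tm_val F v t))"
    by (rule determined_below_map2[where f = "\<lambda>g. g", rotated])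
  then show ?case by auto
qed (auto simp: determined_below_def)

lemma sat_determined: "arithmetical_fm p \<Longrightarrow> \<exists>N. determined_below N (\<lambda>F v. sat F v p)"
proof (induction p)
  case (Eq s t)
  obtain M N where "determined_below M (\<lambda>F v. tm_val F v s)" "determined_below N (\<lambda>F v. tm_val F v t)"
    using tm_val_determined by blast
  from determined_below_map2[where f = "(=)", OF this] show ?case by auto
next
  case (Neg p)
  then show ?case by (auto simp: determined_below_def)
next
  case (Conj p q)
  then obtain M N where "determined_below M (\<lambda>F v. sat F v p)" "determined_below N (\<lambda>F v. sat F v q)"
    by auto
  from determined_below_map2[where f = "(\<and>)", OF this] show ?case by auto
next
  case (ExN i p)
  then obtain N where N: "determined_below N (\<lambda>F v. sat F v p)" by auto
  show ?case unfolding determined_below_def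
  proof (intro exI[of _ N] allI impI)
    fix F F' :: "nat \<Rightarrow> baire" and v v' :: "nat \<Rightarrow> nat"
    assume *: "\<forall>i<N. F i = F' i \<and> v i = v' i"
    have "sat F (v(i := n)) p = sat F' (v'(i := n)) p" for n
      by (rule determined_belowD[OF N]) (use * in auto)
    then show "sat F v (ExN i p) = sat F' v' (ExN i p)" by simp
  qed
qed auto

text \<open>
  A pairing function that is only injective, but is a polynomial and hence given by a term; it is
  used to code countably many functions into one.
\<close>

definition sec :: "nat \<Rightarrow> nat \<Rightarrow> nat" where
  "sec n k = (n + k) * (n + k) + n"

lemma sec_inj: "sec n k = sec n' k' \<longleftrightarrow> n = n' \<and> k = k'"
proof -
  have *: "sec n k < sec n' k'" if "n + k < n' + k'" for n k n' k'
  proof -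
    have "(n + k) * (n + k) + n < Suc (n + k) * Suc (n + k)" by simp
    also have "\<dots> \<le> (n' + k') * (n' + k')" using that by (intro mult_le_mono) auto
    finally show ?thesis by (simp add: sec_def)
  qed
  show ?thesis
  proof
    assume e: "sec n k = sec n' k'"
    then have s: "n + k = n' + k'" using *[of n k n' k'] *[of n' k' n k] by linarith
    then have "n = n'" using e unfolding sec_def by simp
    with s show "n = n' \<and> k = k'" by simp
  qed simp
qed

abbreviation sections :: "(nat \<Rightarrow> nat) \<Rightarrow> (nat \<Rightarrow> bool) \<Rightarrow> (nat \<Rightarrow> baire) \<Rightarrow> nat \<Rightarrow> nat \<Rightarrow> baire" where
  "sections r b F n \<equiv> (\<lambda>i k. F (r i) (if b i then sec n k else k))"

text \<open>One simultaneous substitution covers all later renamings: number variables become terms,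
  and a function is renamed or, when \<open>b i\<close>, replaced by a section at the value of
  number variable 0. Since \<open>sec\<close> is a polynomial, the result is again a term.\<close>

lemma tm_subst:
  "\<exists>s. \<forall>F v. tm_val F v s = tm_val (sections r b F (v 0)) (\<lambda>i. tm_val F v (\<rho> i)) t"
proof (induction t)
  case (NVar i)
  then show ?case by (intro exI[of _ "\<rho> i"]) simp
next
  case Zero
  then show ?case by (intro exI[of _ Zero]) simp
next
  case (Succ t)
  then obtain s where "\<forall>F v. tm_val F v s = tm_val (sections r b F (v 0)) (\<lambda>i. tm_val F v (\<rho> i)) t" by blast
  then show ?case by (intro exI[of _ "Succ s"]) simp
next
  case (Plus t1 t2)
  then obtain s1 s2 where "\<forall>F v. tm_val F v s1 = tm_val (sections r b F (v 0)) (\<lambda>i. tm_val F v (\<rho> i)) t1"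
    "\<forall>F v. tm_val F v s2 = tm_val (sections r b F (v 0)) (\<lambda>i. tm_val F v (\<rho> i)) t2" by blast
  then show ?case by (intro exI[of _ "Plus s1 s2"]) simp
next
  case (Times t1 t2)
  then obtain s1 s2 where "\<forall>F v. tm_val F v s1 = tm_val (sections r b F (v 0)) (\<lambda>i. tm_val F v (\<rho> i)) t1"
    "\<forall>F v. tm_val F v s2 = tm_val (sections r b F (v 0)) (\<lambda>i. tm_val F v (\<rho> i)) t2" by blast
  then show ?case by (intro exI[of _ "Times s1 s2"]) simp
next
  case (App i t)
  then obtain s where "\<forall>F v. tm_val F v s = tm_val (sections r b F (v 0)) (\<lambda>i. tm_val F v (\<rho> i)) t" by blast
  then show ?case
    by (intro exI[of _ "App (r i) (if b i
          then Plus (Times (Plus (NVar 0) s) (Plus (NVar 0) s)) (NVar 0) else s)"])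
       (simp add: sec_def)
qed

lemma fm_subst:
  assumes "arithmetical_fm p"
  shows "\<exists>q. arithmetical_fm q \<and>
    (\<forall>F v. sat F v q = sat (sections r b F (v 0)) (\<lambda>i. tm_val F v (\<rho> i)) p)"
  using assms
proof (induction p arbitrary: \<rho>)
  case (Eq t1 t2)
  obtain s1 s2 where "\<forall>F v. tm_val F v s1 = tm_val (sections r b F (v 0)) (\<lambda>i. tm_val F v (\<rho> i)) t1"
    "\<forall>F v. tm_val F v s2 = tm_val (sections r b F (v 0)) (\<lambda>i. tm_val F v (\<rho> i)) t2"
    using tm_subst by metis
  then show ?case by (intro exI[of _ "Eq s1 s2"]) simp
next
  case (Neg p)
  then obtain q where "arithmetical_fm q"
    "\<forall>F v. sat F v q = sat (sections r b F (v 0)) (\<lambda>i. tm_val F v (\<rho> i)) p" by fastforce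
  then show ?case by (intro exI[of _ "Neg q"]) simp
next
  case (Conj p1 p2)
  obtain q1 where "arithmetical_fm q1"
    "\<forall>F v. sat F v q1 = sat (sections r b F (v 0)) (\<lambda>i. tm_val F v (\<rho> i)) p1"
    using Conj.IH(1)[of \<rho>] Conj.prems by auto
  moreover obtain q2 where "arithmetical_fm q2"
    "\<forall>F v. sat F v q2 = sat (sections r b F (v 0)) (\<lambda>i. tm_val F v (\<rho> i)) p2"
    using Conj.IH(2)[of \<rho>] Conj.prems by auto
  ultimately show ?case by (intro exI[of _ "Conj q1 q2"]) simp
next
  case (ExN i p)
  then have ap: "arithmetical_fm p" by simp
  obtain N where N: "determined_below N (\<lambda>F v. sat F v p)"
    using sat_determined[OF ap] ..
  obtain B where B: "\<And>j. determined_below (B j) (\<lambda>F v. tm_val F v (\<rho> j))"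
    using choice[of "\<lambda>j N. determined_below N (\<lambda>F v. tm_val F v (\<rho> j))"] tm_val_determined by blast
  \<comment> \<open>\<open>M\<close> exceeds every index on which the relevant
    \<open>\<rho> j\<close> depend, so binding it captures nothing; being positive, it leaves the
    section index at variable 0 intact.\<close>
  define M where "M = Suc (\<Sum>j<N. B j)"
  have BM: "B j < M" if "j < N" for j
    unfolding M_def using that by (simp add: less_Suc_eq_le member_le_sum)
  obtain q where q: "arithmetical_fm q"
    "\<And>F v. sat F v q = sat (sections r b F (v 0)) (\<lambda>j. tm_val F v ((\<rho>(i := NVar M)) j)) p"
    using ExN.IH[OF ap, of "\<rho>(i := NVar M)"] by auto
  have "sat F (v(M := n)) q = sat (sections r b F (v 0)) ((\<lambda>j. tm_val F v (\<rho> j))(i := n)) p" for F v n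
  proof -
    have 0: "(v(M := n)) 0 = v 0" by (simp add: M_def)
    have "tm_val F (v(M := n)) (\<rho> j) = tm_val F v (\<rho> j)" if "j < N" for j
      by (rule determined_belowD[OF B]) (use BM[OF that] in auto)
    then show ?thesis unfolding q(2) 0 by (intro determined_belowD[OF N]) auto
  qed
  then show ?case using q(1) by (intro exI[of _ "ExN M q"]) simp
qed auto

text \<open>
  Predicates are closed under quantification in de Bruijn style: the bound variable is read as
  variable 0 and all other variables move up by one.
\<close>

definition arith :: "((nat \<Rightarrow> baire) \<Rightarrow> (nat \<Rightarrow> nat) \<Rightarrow> bool) \<Rightarrow> bool" where
  "arith P \<longleftrightarrow> (\<exists>p. arithmetical_fm p \<and> (\<forall>F v. P F v \<longleftrightarrow> sat F v p))"

lemma arith_sat: "arithmetical_fm p \<Longrightarrow> arith (\<lambda>F v. sat F v p)"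
  by (auto simp: arith_def)

lemma arith_eq:
  assumes "\<And>F v. tm_val F v a = s F v" "\<And>F v. tm_val F v b = t F v"
  shows "arith (\<lambda>F v. s F v = t F v)"
  unfolding arith_def by (intro exI[of _ "Eq a b"]) (simp add: assms)

lemma arith_not: "arith P \<Longrightarrow> arith (\<lambda>F v. \<not> P F v)"
  unfolding arith_def by (metis arithmetical_fm.simps(2) sat.simps(2))

lemma arith_conj: "arith P \<Longrightarrow> arith Q \<Longrightarrow> arith (\<lambda>F v. P F v \<and> Q F v)"
  unfolding arith_def by (metis arithmetical_fm.simps(3) sat.simps(3))

lemma arith_ex:
  assumes "arith P"
  shows "arith (\<lambda>F v. \<exists>n. P F (case_nat n v))"
proof -
  obtain p where p: "arithmetical_fm p" "\<And>F v. P F v \<longleftrightarrow> sat F v p"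
    using assms by (auto simp: arith_def)
  obtain N where N: "determined_below N (\<lambda>F v. sat F v p)"
    using sat_determined[OF p(1)] ..
  obtain q where q: "arithmetical_fm q"
    "\<And>F v. sat F v q = sat F (\<lambda>i. tm_val F v (case_nat (NVar N) NVar i)) p"
    using fm_subst[OF p(1), of "\<lambda>i. i" "\<lambda>_. False" "case_nat (NVar N) NVar"] by auto
  have "sat F (v(N := n)) q = sat F (case_nat n v) p" for F v n
    unfolding q(2) by (rule determined_belowD[OF N]) (auto split: nat.splits)
  then show ?thesis unfolding arith_def p(2)
    using q(1) by (intro exI[of _ "ExN N q"]) simp
qed

lemma arith_all: "arith P \<Longrightarrow> arith (\<lambda>F v. \<forall>n. P F (case_nat n v))"
  using arith_not[OF arith_ex[OF arith_not]] by fastforce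

lemma arith_disj: "arith P \<Longrightarrow> arith Q \<Longrightarrow> arith (\<lambda>F v. P F v \<or> Q F v)"
  using arith_not[OF arith_conj[OF arith_not arith_not]] by fastforce

lemma arith_sections:
  assumes "arith P"
  shows "arith (\<lambda>F v. P (\<lambda>i k. F (r i) (if b i then sec (v 0) k else k)) v)"
proof -
  obtain p where p: "arithmetical_fm p" "\<And>F v. P F v \<longleftrightarrow> sat F v p"
    using assms by (auto simp: arith_def)
  show ?thesis using fm_subst[OF p(1), of r b NVar] by (auto simp: arith_def p(2))
qed

lemma arith_fun_rename: "arith P \<Longrightarrow> arith (\<lambda>F v. P (\<lambda>i. F (r i)) v)"
  using arith_sections[of P r "\<lambda>_. False"] by simp

lemma arith_num_rename:
  assumes "arith P"
  shows "arith (\<lambda>F v. P F (\<lambda>i. v (r i)))"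
proof -
  obtain p where p: "arithmetical_fm p" "\<And>F v. P F v \<longleftrightarrow> sat F v p"
    using assms by (auto simp: arith_def)
  show ?thesis using fm_subst[OF p(1), of "\<lambda>i. i" "\<lambda>_. False" "\<lambda>i. NVar (r i)"]
    by (auto simp: arith_def p(2))
qed

section \<open>Semantic \<open>\<Sigma>\<^sup>1\<^sub>1\<close> predicates and their closure
  properties\<close>

text \<open>The \<open>m\<close> quantified functions stand in front of the free ones, so blocks can
  be joined and lengthened by index shifts.\<close>

definition sigma :: "((nat \<Rightarrow> baire) \<Rightarrow> (nat \<Rightarrow> nat) \<Rightarrow> bool) \<Rightarrow> bool" where
  "sigma P \<longleftrightarrow> (\<exists>A m. arith A \<and>
     (\<forall>F v. P F v \<longleftrightarrow> (\<exists>G. (\<forall>i. G (i + m) = F i) \<and> A G v)))"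

lemma sigmaI:
  assumes "arith A" "\<And>F v. P F v \<longleftrightarrow> (\<exists>G. (\<forall>i. G (i + m) = F i) \<and> A G v)"
  shows "sigma P"
  using assms unfolding sigma_def by blast

lemma sigma_arith: "arith P \<Longrightarrow> sigma P"
  by (rule sigmaI[of P _ 0]) (auto simp flip: fun_eq_iff)

text \<open>\<open>L\<close> lists the block of \<open>A\<close>, then that of \<open>B\<close>,
  then the free functions; \<open>A'\<close> skips the second block and \<open>B'\<close> the first.
  In a disjunction the block of the other side is filled arbitrarily.\<close>

lemma sigma_join:
  fixes m k :: nat and A B :: "(nat \<Rightarrow> baire) \<Rightarrow> (nat \<Rightarrow> nat) \<Rightarrow> bool"
  assumes P: "\<And>F v. P F v \<longleftrightarrow> (\<exists>G. (\<forall>i. G (i + m) = F i) \<and> A G v)"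
    and Q: "\<And>F v. Q F v \<longleftrightarrow> (\<exists>G. (\<forall>i. G (i + k) = F i) \<and> B G v)"
  defines "A' \<equiv> (\<lambda>L. A (\<lambda>i. L (if i < m then i else i + k)))"
    and "B' \<equiv> (\<lambda>L. B (\<lambda>i. L (i + m)))"
  shows "P F v \<and> Q F v \<longleftrightarrow> (\<exists>L. (\<forall>i. L (i + (m + k)) = F i) \<and> A' L v \<and> B' L v)" (is ?conj)
    and "P F v \<or> Q F v \<longleftrightarrow> (\<exists>L. (\<forall>i. L (i + (m + k)) = F i) \<and> (A' L v \<or> B' L v))" (is ?disj)
proof -
  have join: "\<exists>L. (\<forall>i. L (i + (m + k)) = F i) \<and> (A' L v \<longleftrightarrow> A G v) \<and> (B' L v \<longleftrightarrow> B H v)"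
    if G: "\<forall>i. G (i + m) = F i" and H: "\<forall>i. H (i + k) = F i" for G H
  proof (intro exI conjI allI)
    let ?L = "\<lambda>i. if i < m then G i else H (i - m)"
    show "?L (i + (m + k)) = F i" for i
      using H by (simp add: add.commute add.left_commute)
    have "?L (if i < m then i else i + k) = G i" for i
      using G[rule_format, of "i - m"] H[rule_format, of "i - m"] by (auto simp: add.commute)
    then show "A' ?L v \<longleftrightarrow> A G v" by (simp add: A'_def)
    show "B' ?L v \<longleftrightarrow> B H v" by (simp add: B'_def)
  qed
  have split: "(A' L v \<longrightarrow> P F v) \<and> (B' L v \<longrightarrow> Q F v)" if L: "\<forall>i. L (i + (m + k)) = F i" for L
  proof (intro conjI impI)
    assume "A' L v"
    then show "P F v" unfolding P A'_def
      by (intro exI[of _ "\<lambda>i. L (if i < m then i else i + k)"]) (use L in \<open>simp add: add.assoc\<close>)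
  next
    assume "B' L v"
    then show "Q F v" unfolding Q B'_def
      by (intro exI[of _ "\<lambda>i. L (i + m)"]) (use L in \<open>simp add: add.commute add.left_commute\<close>)
  qed
  show ?conj
  proof
    assume "P F v \<and> Q F v"
    then obtain G H where "\<forall>i. G (i + m) = F i" "A G v" "\<forall>i. H (i + k) = F i" "B H v"
      unfolding P Q by blast
    with join[of G H] show "\<exists>L. (\<forall>i. L (i + (m + k)) = F i) \<and> A' L v \<and> B' L v" by blast
  qed (use split in blast)
  have dummy: "\<exists>H. \<forall>i. H (i + n) = F i" for n
    by (rule exI[of _ "\<lambda>i. F (i - n)"]) simp
  show ?disj
  proof
    assume "P F v \<or> Q F v"
    then obtain G H where "\<forall>i. G (i + m) = F i" "\<forall>i. H (i + k) = F i" "A G v \<or> B H v"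
      unfolding P Q using dummy[of m] dummy[of k] by blast
    with join[of G H] show "\<exists>L. (\<forall>i. L (i + (m + k)) = F i) \<and> (A' L v \<or> B' L v)" by blast
  qed (use split in blast)
qed

lemma sigma_conj:
  assumes "sigma P" "sigma Q"
  shows "sigma (\<lambda>F v. P F v \<and> Q F v)"
proof -
  obtain A m where A: "arith A" "\<And>F v. P F v \<longleftrightarrow> (\<exists>G. (\<forall>i. G (i + m) = F i) \<and> A G v)"
    using assms(1) unfolding sigma_def by blast
  obtain B k where B: "arith B" "\<And>F v. Q F v \<longleftrightarrow> (\<exists>G. (\<forall>i. G (i + k) = F i) \<and> B G v)"
    using assms(2) unfolding sigma_def by blast
  show ?thesis
    by (rule sigmaI[OF _ sigma_join(1)[OF A(2) B(2)]])
       (intro arith_conj arith_fun_rename[OF A(1)] arith_fun_rename[OF B(1)])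
qed

lemma sigma_disj:
  assumes "sigma P" "sigma Q"
  shows "sigma (\<lambda>F v. P F v \<or> Q F v)"
proof -
  obtain A m where A: "arith A" "\<And>F v. P F v \<longleftrightarrow> (\<exists>G. (\<forall>i. G (i + m) = F i) \<and> A G v)"
    using assms(1) unfolding sigma_def by blast
  obtain B k where B: "arith B" "\<And>F v. Q F v \<longleftrightarrow> (\<exists>G. (\<forall>i. G (i + k) = F i) \<and> B G v)"
    using assms(2) unfolding sigma_def by blast
  show ?thesis
    by (rule sigmaI[OF _ sigma_join(2)[OF A(2) B(2)]])
       (intro arith_disj arith_fun_rename[OF A(1)] arith_fun_rename[OF B(1)])
qed

lemma sigma_fun_rename:
  assumes "sigma P"
  shows "sigma (\<lambda>F v. P (\<lambda>i. F (r i)) v)"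
proof -
  obtain A m where *: "arith A" "\<And>F v. P F v \<longleftrightarrow> (\<exists>G. (\<forall>i. G (i + m) = F i) \<and> A G v)"
    using assms unfolding sigma_def by blast
  show ?thesis
  proof (rule sigmaI[OF arith_fun_rename[OF *(1), of "\<lambda>i. if i < m then i else r (i - m) + m"]])
    fix F v
    show "P (\<lambda>i. F (r i)) v \<longleftrightarrow>
      (\<exists>G. (\<forall>i. G (i + m) = F i) \<and> A (\<lambda>i. G (if i < m then i else r (i - m) + m)) v)"
    proof
      assume "P (\<lambda>i. F (r i)) v"
      then obtain G where G: "\<forall>i. G (i + m) = F (r i)" "A G v" unfolding * by blast
      define H where "H = (\<lambda>i. if i < m then G i else F (i - m))"
      have "(\<lambda>i. H (if i < m then i else r (i - m) + m)) = G"
      proof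
        fix i show "H (if i < m then i else r (i - m) + m) = G i"
          using G(1)[rule_format, of "i - m"] by (auto simp: H_def)
      qed
      then show "\<exists>G. (\<forall>i. G (i + m) = F i) \<and> A (\<lambda>i. G (if i < m then i else r (i - m) + m)) v"
        using G(2) by (intro exI[of _ H]) (auto simp: H_def)
    next
      assume "\<exists>G. (\<forall>i. G (i + m) = F i) \<and> A (\<lambda>i. G (if i < m then i else r (i - m) + m)) v"
      then obtain G where G: "\<forall>i. G (i + m) = F i" "A (\<lambda>i. G (if i < m then i else r (i - m) + m)) v" by blast
      show "P (\<lambda>i. F (r i)) v" unfolding *
        by (rule exI[of _ "\<lambda>i. G (if i < m then i else r (i - m) + m)"]) (use G in auto)
    qed
  qed
qed

lemma sigma_num_rename:
  assumes "sigma P"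
  shows "sigma (\<lambda>F v. P F (\<lambda>i. v (r i)))"
proof -
  obtain A m where *: "arith A" "\<And>F v. P F v \<longleftrightarrow> (\<exists>G. (\<forall>i. G (i + m) = F i) \<and> A G v)"
    using assms unfolding sigma_def by blast
  show ?thesis
    by (rule sigmaI[OF arith_num_rename[OF *(1)]]) (simp add: *(2))
qed

lemma sigma_ex_fun:
  assumes "sigma (\<lambda>F v. P (\<lambda>i. F (Suc i)) v (F 0))"
  shows "sigma (\<lambda>F v. \<exists>g. P F v g)"
proof -
  obtain A m where *: "arith A"
    "\<And>F v. P (\<lambda>i. F (Suc i)) v (F 0) \<longleftrightarrow> (\<exists>G. (\<forall>i. G (i + m) = F i) \<and> A G v)"
    using assms unfolding sigma_def by blast
  have "(\<exists>g. P F v g) \<longleftrightarrow> (\<exists>G. (\<forall>i. G (i + Suc m) = F i) \<and> A G v)" for F v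
  proof
    assume "\<exists>g. P F v g"
    then obtain g where "P F v g" by blast
    then obtain G where G: "\<forall>i. G (i + m) = case_nat g F i" "A G v"
      using *(2)[of "case_nat g F" v] by auto
    show "\<exists>G. (\<forall>i. G (i + Suc m) = F i) \<and> A G v"
      using G(1)[rule_format, of "Suc _"] G(2) by (intro exI[of _ G]) simp
  next
    assume "\<exists>G. (\<forall>i. G (i + Suc m) = F i) \<and> A G v"
    then obtain G where G: "\<forall>i. G (i + Suc m) = F i" "A G v" by blast
    then have "P F v (G m)"
      using *(2)[of "\<lambda>i. G (i + m)" v] by auto
    then show "\<exists>g. P F v g" by blast
  qed
  then show ?thesis by (rule sigmaI[OF *(1)])
qed

lemma sigma_ex:
  assumes "sigma (\<lambda>F v. P F (\<lambda>i. v (Suc i)) (v 0))"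
  shows "sigma (\<lambda>F v. \<exists>n. P F v n)"
proof -
  obtain A m where *: "arith A"
    "\<And>F v. P F (\<lambda>i. v (Suc i)) (v 0) \<longleftrightarrow> (\<exists>G. (\<forall>i. G (i + m) = F i) \<and> A G v)"
    using assms unfolding sigma_def by blast
  have "P F v n \<longleftrightarrow> (\<exists>G. (\<forall>i. G (i + m) = F i) \<and> A G (case_nat n v))" for F v n
    using *(2)[of F "case_nat n v"] by simp
  then show ?thesis by (intro sigmaI[OF arith_ex[OF *(1)], of _ m]) blast
qed

text \<open>Countable choice picks a block of witnesses for every \<open>n\<close>. For each
  \<open>i < m\<close> the functions chosen at index \<open>i\<close> are packed into one, and
  \<open>sec\<close> recovers them as sections.\<close>

lemma sigma_all:
  assumes "sigma (\<lambda>F v. P F (\<lambda>i. v (Suc i)) (v 0))"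
  shows "sigma (\<lambda>F v. \<forall>n. P F v n)"
proof -
  obtain A m where *: "arith A"
    "\<And>F v. P F (\<lambda>i. v (Suc i)) (v 0) \<longleftrightarrow> (\<exists>G. (\<forall>i. G (i + m) = F i) \<and> A G v)"
    using assms unfolding sigma_def by blast
  have P: "P F v n \<longleftrightarrow> (\<exists>G. (\<forall>i. G (i + m) = F i) \<and> A G (case_nat n v))" for F v n
    using *(2)[of F "case_nat n v"] by simp
  let ?A = "\<lambda>G n v. A (\<lambda>i k. G i (if i < m then sec n k else k)) (case_nat n v)"
  have ar: "arith (\<lambda>G v. \<forall>n. ?A G n v)"
    using arith_all[OF arith_sections[OF *(1), of "\<lambda>i. i" "\<lambda>i. i < m"]] by (simp only: nat.case(1))
  have "(\<forall>n. P F v n) \<longleftrightarrow> (\<exists>G. (\<forall>i. G (i + m) = F i) \<and> (\<forall>n. ?A G n v))" for F v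
  proof
    assume "\<forall>n. P F v n"
    then obtain H where H: "\<And>n i. H n (i + m) = F i" "\<And>n. A (H n) (case_nat n v)"
      unfolding P by metis
    define G where "G i q = (if i < m then H (fst (inv (\<lambda>(n, k). sec n k) q)) i (snd (inv (\<lambda>(n, k). sec n k) q))
      else F (i - m) q)" for i q
    have "inj (\<lambda>(n, k). sec n k)" by (auto simp: inj_def sec_inj)
    then have inv: "inv (\<lambda>(n, k). sec n k) (sec n k) = (n, k)" for n k
      using inv_f_f[of "\<lambda>(n, k). sec n k" "(n, k)"] by simp
    have "(\<lambda>i k. G i (if i < m then sec n k else k)) = H n" for n
    proof (intro ext)
      fix i k show "G i (if i < m then sec n k else k) = H n i k"
        using H(1)[of n "i - m"] by (cases "i < m") (simp_all add: G_def inv)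
    qed
    then show "\<exists>G. (\<forall>i. G (i + m) = F i) \<and> (\<forall>n. ?A G n v)"
      using H(2) by (intro exI[of _ G]) (auto simp: G_def)
  next
    assume "\<exists>G. (\<forall>i. G (i + m) = F i) \<and> (\<forall>n. ?A G n v)"
    then obtain G where G: "\<forall>i. G (i + m) = F i" "\<And>n. ?A G n v" by blast
    have "P F v n" for n unfolding P
      by (intro exI[of _ "\<lambda>i k. G i (if i < m then sec n k else k)"] conjI G(2)) (use G(1) in auto)
    then show "\<forall>n. P F v n" ..
  qed
  then show ?thesis by (rule sigmaI[OF ar])
qed

section \<open>From formulas to semantic predicates and back\<close>

lemma sigma_sat: "Sigma11_fm p \<Longrightarrow> sigma (\<lambda>F v. sat F v p)"
proof (induction rule: Sigma11_fm.induct)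
  case (arith p)
  then show ?case by (intro sigma_arith arith_sat)
next
  case (ex p i)
  have "(\<lambda>j. if j = i then F 0 else F (Suc j)) = (\<lambda>j. F (Suc j))(i := F 0)" for F :: "nat \<Rightarrow> baire"
    by auto
  then have "sigma (\<lambda>F v. sat ((\<lambda>j. F (Suc j))(i := F 0)) v p)"
    using sigma_fun_rename[OF ex.IH, of "\<lambda>j. if j = i then 0 else Suc j"] by (simp add: if_distrib)
  then show ?case unfolding sat.simps by (rule sigma_ex_fun)
qed

lemma Sigma11_fm_block:
  "Sigma11_fm q \<Longrightarrow> \<exists>q'. Sigma11_fm q' \<and>
     (\<forall>F v. sat F v q' \<longleftrightarrow> (\<exists>G. (\<forall>i. i < M \<or> i \<ge> M + m \<longrightarrow> G i = F i) \<and> sat G v q))"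
proof (induction m)
  case 0
  moreover have "(\<forall>i. i < M \<or> i \<ge> M + 0 \<longrightarrow> G i = F i) \<longleftrightarrow> G = F" for F G :: "nat \<Rightarrow> baire"
    by (auto simp: fun_eq_iff not_less[symmetric])
  ultimately show ?case by (intro exI[of _ q]) simp
next
  case (Suc m)
  then obtain q' where q': "Sigma11_fm q'"
    "\<And>F v. sat F v q' \<longleftrightarrow> (\<exists>G. (\<forall>i. i < M \<or> i \<ge> M + m \<longrightarrow> G i = F i) \<and> sat G v q)" by blast
  show ?case
  proof (intro exI[of _ "ExF (M + m) q'"] conjI allI)
    show "Sigma11_fm (ExF (M + m) q')" using q'(1) by (rule Sigma11_fm.ex)
    fix F v
    show "sat F v (ExF (M + m) q') \<longleftrightarrow>
      (\<exists>G. (\<forall>i. i < M \<or> i \<ge> M + Suc m \<longrightarrow> G i = F i) \<and> sat G v q)" (is "?l \<longleftrightarrow> ?r")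
    proof
      assume ?l
      then obtain g G where "\<forall>i. i < M \<or> i \<ge> M + m \<longrightarrow> G i = (F(M + m := g)) i" "sat G v q"
        by (auto simp: q'(2))
      then show ?r by (intro exI[of _ G]) auto
    next
      assume ?r
      then obtain G where G: "\<forall>i. i < M \<or> i \<ge> M + Suc m \<longrightarrow> G i = F i" "sat G v q" by blast
      have "G i = (F(M + m := G (M + m))) i" if "i < M \<or> i \<ge> M + m" for i
        using that G(1)[rule_format, of i] by (cases "i = M + m") auto
      then show ?l using G(2) unfolding sat.simps q'(2) by blast
    qed
  qed
qed

text \<open>The quantified block moves to the \<open>m\<close> indices from \<open>N\<close> on. The
  matrix depends only on indices below \<open>N\<close>, so its free functions stay clear of that
  block.\<close>

lemma sigma_fm:
  assumes "sigma P"
  shows "\<exists>p. Sigma11_fm p \<and> (\<forall>F v. sat F v p \<longleftrightarrow> P F v)"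
proof -
  obtain A m where *: "arith A" "\<And>F v. P F v \<longleftrightarrow> (\<exists>G. (\<forall>i. G (i + m) = F i) \<and> A G v)"
    using assms unfolding sigma_def by blast
  obtain a where a: "arithmetical_fm a" "\<And>F v. A F v \<longleftrightarrow> sat F v a"
    using *(1) by (auto simp: arith_def)
  obtain N where N: "determined_below N (\<lambda>F v. sat F v a)"
    using sat_determined[OF a(1)] ..
  let ?r = "\<lambda>i. if i < m then N + i else i - m"
  obtain q where q: "arithmetical_fm q" "\<And>F v. A (\<lambda>i. F (?r i)) v \<longleftrightarrow> sat F v q"
    using arith_fun_rename[OF *(1), of ?r] by (auto simp: arith_def)
  obtain q' where q': "Sigma11_fm q'"
    "\<And>F v. sat F v q' \<longleftrightarrow> (\<exists>G. (\<forall>i. i < N \<or> i \<ge> N + m \<longrightarrow> G i = F i) \<and> sat G v q)"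
    using Sigma11_fm_block[OF Sigma11_fm.arith[OF q(1)]] by blast
  have "sat F v q' \<longleftrightarrow> P F v" for F v
  proof
    assume "sat F v q'"
    then obtain G where G: "\<forall>i. i < N \<or> i \<ge> N + m \<longrightarrow> G i = F i" "A (\<lambda>i. G (?r i)) v"
      using q' q by blast
    have "sat (\<lambda>i. G (?r i)) v a = sat (\<lambda>i. if i < m then G (N + i) else F (i - m)) v a"
      by (rule determined_belowD[OF N]) (use G in auto)
    then show "P F v" using G(2) unfolding * a(2)
      by (intro exI[of _ "\<lambda>i. if i < m then G (N + i) else F (i - m)"]) auto
  next
    assume "P F v"
    then obtain G where G: "\<forall>i. G (i + m) = F i" "sat G v a" unfolding * a(2) by blast
    define H where "H i = (if i < N \<or> i \<ge> N + m then F i else G (i - N))" for i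
    have "sat (\<lambda>i. H (?r i)) v a = sat G v a"
    proof (rule determined_belowD[OF N], intro conjI refl)
      fix i assume "i < N"
      then show "H (?r i) = G i" using G(1)[rule_format, of "i - m"] by (auto simp: H_def)
    qed
    then have "sat H v q" using G(2) q(2) a(2) by blast
    then show "sat F v q'" unfolding q' by (intro exI[of _ H]) (auto simp: H_def)
  qed
  then show ?thesis using q'(1) by blast
qed

section \<open>\<open>\<Delta>\<^sup>1\<^sub>1\<close> predicates and definable numbers and
  functions\<close>

definition delta :: "((nat \<Rightarrow> baire) \<Rightarrow> (nat \<Rightarrow> nat) \<Rightarrow> bool) \<Rightarrow> bool" where
  "delta P \<longleftrightarrow> sigma P \<and> sigma (\<lambda>F v. \<not> P F v)"

text \<open>A \<open>\<Sigma>\<^sup>1\<^sub>1\<close> graph of a total function is automatically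
  \<open>\<Delta>\<^sup>1\<^sub>1\<close>: a wrong value is one that differs from the right
  one.\<close>

definition delta_num :: "((nat \<Rightarrow> baire) \<Rightarrow> (nat \<Rightarrow> nat) \<Rightarrow> nat) \<Rightarrow> bool" where
  "delta_num t \<longleftrightarrow> sigma (\<lambda>F v. t F (\<lambda>i. v (Suc i)) = v 0)"

definition delta_fun :: "((nat \<Rightarrow> baire) \<Rightarrow> (nat \<Rightarrow> nat) \<Rightarrow> baire) \<Rightarrow> bool" where
  "delta_fun g \<longleftrightarrow> delta_num (\<lambda>F v. g F (\<lambda>i. v (Suc i)) (v 0))"

lemma delta_sigma: "delta P \<Longrightarrow> sigma P"
  by (simp add: delta_def)

lemma delta_arith: "arith P \<Longrightarrow> delta P"
  by (simp add: delta_def sigma_arith arith_not)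

lemma delta_not: "delta P \<Longrightarrow> delta (\<lambda>F v. \<not> P F v)"
  by (simp add: delta_def)

lemma delta_conj: "delta P \<Longrightarrow> delta Q \<Longrightarrow> delta (\<lambda>F v. P F v \<and> Q F v)"
  unfolding delta_def de_Morgan_conj by (elim conjE, intro conjI sigma_conj sigma_disj)

lemma delta_disj: "delta P \<Longrightarrow> delta Q \<Longrightarrow> delta (\<lambda>F v. P F v \<or> Q F v)"
  unfolding delta_def de_Morgan_disj by (elim conjE, intro conjI sigma_conj sigma_disj)

lemma delta_imp: "delta P \<Longrightarrow> delta Q \<Longrightarrow> delta (\<lambda>F v. P F v \<longrightarrow> Q F v)"
  unfolding imp_conv_disj by (intro delta_disj delta_not)

lemma delta_iff: "delta P \<Longrightarrow> delta Q \<Longrightarrow> delta (\<lambda>F v. P F v \<longleftrightarrow> Q F v)"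
  unfolding iff_conv_conj_imp by (intro delta_conj delta_imp)

lemma delta_ex: "delta (\<lambda>F v. P F (\<lambda>i. v (Suc i)) (v 0)) \<Longrightarrow> delta (\<lambda>F v. \<exists>n. P F v n)"
  unfolding delta_def not_ex by (elim conjE, intro conjI sigma_ex sigma_all)

lemma delta_all: "delta (\<lambda>F v. P F (\<lambda>i. v (Suc i)) (v 0)) \<Longrightarrow> delta (\<lambda>F v. \<forall>n. P F v n)"
  unfolding delta_def not_all by (elim conjE, intro conjI sigma_ex sigma_all)

lemma delta_num_shift: "delta_num t \<Longrightarrow> delta_num (\<lambda>F v. t F (\<lambda>i. v (Suc i)))"
  unfolding delta_num_def by (drule sigma_num_rename[where r = "case_nat 0 (\<lambda>i. Suc (Suc i))"]) simp

lemma delta_num_fun_shift: "delta_num t \<Longrightarrow> delta_num (\<lambda>F. t (\<lambda>i. F (Suc i)))"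
  unfolding delta_num_def by (rule sigma_fun_rename)

lemma sigma_subst_num:
  assumes "sigma (\<lambda>F v. P F (\<lambda>i. v (Suc i)) (v 0))" "delta_num t"
  shows "sigma (\<lambda>F v. P F v (t F v))"
proof -
  have "sigma (\<lambda>F v. \<exists>n. t F v = n \<and> P F v n)"
    using assms by (intro sigma_ex sigma_conj) (simp_all add: delta_num_def)
  then show ?thesis by simp
qed

lemma delta_subst_num:
  "delta (\<lambda>F v. P F (\<lambda>i. v (Suc i)) (v 0)) \<Longrightarrow> delta_num t \<Longrightarrow> delta (\<lambda>F v. P F v (t F v))"
  unfolding delta_def by (blast intro: sigma_subst_num[of P] sigma_subst_num[of "\<lambda>F v n. \<not> P F v n"])

lemma delta_num_subst_num:
  assumes "delta_num (\<lambda>F v. u F (\<lambda>i. v (Suc i)) (v 0))" "delta_num t"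
  shows "delta_num (\<lambda>F v. u F v (t F v))"
  unfolding delta_num_def
proof (rule sigma_subst_num[OF _ delta_num_shift[OF assms(2)]])
  show "sigma (\<lambda>F v. u F (\<lambda>i. v (Suc (Suc i))) (v 0) = v (Suc 0))"
    using sigma_num_rename[OF assms(1)[unfolded delta_num_def],
      of "\<lambda>i. if i = 0 then 1 else if i = 1 then 0 else i"] by simp
qed

lemma delta_num_tm:
  assumes "\<And>F v. tm_val F v s = t F (\<lambda>i. v (Suc i))"
  shows "delta_num t"
  unfolding delta_num_def
  by (intro sigma_arith arith_eq[where a = s and b = "NVar 0"]) (simp_all add: assms)

lemma delta_num_var: "delta_num (\<lambda>F v. v i)"
  by (rule delta_num_tm[where s = "NVar (Suc i)"]) simp

lemma delta_num_const: "delta_num (\<lambda>F v. k)"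
proof (rule delta_num_tm)
  show "tm_val F v ((Succ ^^ k) Zero) = k" for F v by (induction k) simp_all
qed

lemma delta_num_app: "delta_num t \<Longrightarrow> delta_num (\<lambda>F v. F i (t F v))"
  by (rule delta_num_subst_num[where u = "\<lambda>F v. F i"])
     (rule delta_num_tm[where s = "App i (NVar 1)"], simp)

lemma delta_num_map2:
  assumes "delta_num (\<lambda>F v. f (v 0) (v 1))" "delta_num s" "delta_num t"
  shows "delta_num (\<lambda>F v. f (s F v) (t F v))"
proof (rule delta_num_subst_num[OF _ assms(3)])
  show "delta_num (\<lambda>F v. f (s F (\<lambda>i. v (Suc i))) (v 0))"
  proof (rule delta_num_subst_num[OF _ delta_num_shift[OF assms(2)]])
    show "delta_num (\<lambda>F v. f (v 0) (v (Suc 0)))" using assms(1) by simp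
  qed
qed

lemma delta_num_Suc: "delta_num t \<Longrightarrow> delta_num (\<lambda>F v. Suc (t F v))"
  by (rule delta_num_map2[where f = "\<lambda>a _. Suc a"])
     (rule delta_num_tm[where s = "Succ (NVar 1)"], simp)

lemma delta_num_plus: "delta_num s \<Longrightarrow> delta_num t \<Longrightarrow> delta_num (\<lambda>F v. s F v + t F v)"
  by (rule delta_num_map2[where f = "(+)"])
     (rule delta_num_tm[where s = "Plus (NVar 1) (NVar 2)"], simp add: numeral_2_eq_2)

lemma delta_num_times: "delta_num s \<Longrightarrow> delta_num t \<Longrightarrow> delta_num (\<lambda>F v. s F v * t F v)"
  by (rule delta_num_map2[where f = "(*)"])
     (rule delta_num_tm[where s = "Times (NVar 1) (NVar 2)"], simp add: numeral_2_eq_2)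

lemma delta_eq:
  assumes "delta_num s" "delta_num t"
  shows "delta (\<lambda>F v. s F v = t F v)"
proof (rule delta_subst_num[OF _ assms(1)], rule delta_subst_num[OF _ delta_num_shift[OF assms(2)]])
  show "delta (\<lambda>F v. v (Suc 0) = v 0)"
    by (intro delta_arith arith_eq[where a = "NVar 1" and b = "NVar 0"]) simp_all
qed

lemma delta_less:
  assumes "delta_num s" "delta_num t"
  shows "delta (\<lambda>F v. s F v < t F v)"
proof -
  have *: "a < b \<longleftrightarrow> (\<exists>n. a + Suc n = b)" for a b :: nat
    by (auto simp: less_iff_Suc_add)
  show ?thesis unfolding *
    by (intro delta_ex delta_eq delta_num_plus delta_num_Suc delta_num_var delta_num_shift assms)
qed

lemma delta_num_graph: "sigma (\<lambda>F v. t F (\<lambda>i. v (Suc i)) = v 0) \<Longrightarrow> delta_num t"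
  by (simp add: delta_num_def)

lemma delta_num_if:
  assumes "delta P" "delta_num s" "delta_num t"
  shows "delta_num (\<lambda>F v. if P F v then s F v else t F v)"
proof (rule delta_num_graph)
  have "delta (\<lambda>F v. P F (\<lambda>i. v (Suc i)))"
    using assms(1) sigma_num_rename[where r = Suc] by (auto simp: delta_def)
  then have "delta (\<lambda>F v. (P F (\<lambda>i. v (Suc i)) \<longrightarrow> s F (\<lambda>i. v (Suc i)) = v 0) \<and>
      (\<not> P F (\<lambda>i. v (Suc i)) \<longrightarrow> t F (\<lambda>i. v (Suc i)) = v 0))"
    by (intro delta_conj delta_imp delta_not delta_eq delta_num_shift assms delta_num_var)
  then show "sigma (\<lambda>F v. (if P F (\<lambda>i. v (Suc i)) then s F (\<lambda>i. v (Suc i)) else t F (\<lambda>i. v (Suc i))) = v 0)"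
    by (simp add: delta_sigma if_split_eq1)
qed

lemma delta_num_prod_encode:
  "delta_num s \<Longrightarrow> delta_num t \<Longrightarrow> delta_num (\<lambda>F v. prod_encode (s F v, t F v))"
proof (rule delta_num_map2[where f = "\<lambda>a b. prod_encode (a, b)"], rule delta_num_graph)
  \<comment> \<open>Doubling clears the division in the triangular number and leaves a polynomial
    identity.\<close>
  have "prod_encode (a, b) = c \<longleftrightarrow> (a + b) * Suc (a + b) + (a + a) = c + c" for a b c
  proof -
    have "2 * triangle n = n * Suc n" for n unfolding triangle_def by simp
    from this[of "a + b"] show ?thesis unfolding prod_encode_def by auto
  qed
  then show "sigma (\<lambda>F v. prod_encode (v (Suc 0), v (Suc 1)) = v 0)"
    by (simp only:) (intro delta_sigma delta_eq delta_num_plus delta_num_times delta_num_Suc delta_num_var)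
qed

lemma delta_funI: "delta_num (\<lambda>F v. g F (\<lambda>i. v (Suc i)) (v 0)) \<Longrightarrow> delta_fun g"
  by (simp add: delta_fun_def)

lemma sigma_subst_fun:
  assumes "sigma (\<lambda>F v. P (\<lambda>i. F (Suc i)) v (F 0))" "delta_fun g"
  shows "sigma (\<lambda>F v. P F v (g F v))"
proof -
  have "sigma (\<lambda>F v. \<exists>h. (\<forall>k. g F v k = h k) \<and> P F v h)"
    using assms(2)[unfolded delta_fun_def, THEN delta_num_fun_shift]
    by (intro sigma_ex_fun sigma_conj assms sigma_all delta_sigma[OF delta_eq] delta_num_app delta_num_var)
  moreover have "(\<exists>h. (\<forall>k. g F v k = h k) \<and> P F v h) \<longleftrightarrow> P F v (g F v)" for F v
    by (auto simp flip: fun_eq_iff)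
  ultimately show ?thesis by simp
qed

lemma sigma_subst2:
  assumes "sigma (\<lambda>F v. R (F 0) (v 0) (v 1))" "delta_fun x" "delta_num s" "delta_num t"
  shows "sigma (\<lambda>F v. R (x F v) (s F v) (t F v))"
proof (rule sigma_subst_fun[OF _ assms(2)])
  show "sigma (\<lambda>F v. R (F 0) (s (\<lambda>i. F (Suc i)) v) (t (\<lambda>i. F (Suc i)) v))"
  proof (rule sigma_subst_num[OF _ delta_num_fun_shift[OF assms(3)]])
    show "sigma (\<lambda>F v. R (F 0) (v 0) (t (\<lambda>i. F (Suc i)) (\<lambda>i. v (Suc i))))"
    proof (rule sigma_subst_num[OF _ delta_num_fun_shift[OF delta_num_shift[OF assms(4)]]])
      show "sigma (\<lambda>F v. R (F 0) (v (Suc 0)) (v 0))"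
        using sigma_num_rename[OF assms(1), of "\<lambda>i. if i = 0 then 1 else 0"] by simp
    qed
  qed
qed

lemma delta_subst2:
  "delta (\<lambda>F v. R (F 0) (v 0) (v 1)) \<Longrightarrow> delta_fun x \<Longrightarrow> delta_num s \<Longrightarrow> delta_num t \<Longrightarrow>
    delta (\<lambda>F v. R (x F v) (s F v) (t F v))"
  unfolding delta_def by (blast intro: sigma_subst2[of R] sigma_subst2[of "\<lambda>x a b. \<not> R x a b"])

text \<open>
  Every number codes an eventually zero sequence, so that it can serve both as a finite sequence
  and as an assignment to the number variables.
\<close>

primrec sq :: "nat \<Rightarrow> nat \<Rightarrow> nat" where
  "sq c 0 = fst (prod_decode c)"
| "sq c (Suc i) = sq (snd (prod_decode c)) i"

lemma sq_Cons [simp]: "sq (prod_encode (a, c)) = case_nat a (sq c)"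
  by (rule ext) (simp split: nat.split)

lemma sq_0 [simp]: "sq 0 = (\<lambda>_. 0)"
proof
  have "prod_decode 0 = (0, 0)" by (simp add: prod_decode_def prod_decode_aux.simps)
  then show "sq 0 i = 0" for i by (induction i) simp_all
qed

lemma sq_initial_segment: "\<exists>c. \<forall>i<l. sq c i = z i"
proof (induction l arbitrary: z)
  case (Suc l)
  from Suc[of "\<lambda>i. z (Suc i)"] obtain c where "\<forall>i<l. sq c i = z (Suc i)" ..
  then show ?case by (intro exI[of _ "prod_encode (z 0, c)"]) (simp add: less_Suc_eq_0_disj split: nat.split)
qed simp

lemma sq_update: "\<exists>d. sq d = (sq c)(i := n)"
proof (induction i arbitrary: c)
  case 0
  show ?case
    by (rule exI[of _ "prod_encode (n, snd (prod_decode c))"]) (auto simp: fun_eq_iff split: nat.split)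
next
  case (Suc i)
  from Suc[of "snd (prod_decode c)"] obtain d where d: "sq d = (sq (snd (prod_decode c)))(i := n)" ..
  show ?case
    by (rule exI[of _ "prod_encode (fst (prod_decode c), d)"]) (auto simp: d fun_eq_iff split: nat.split)
qed

text \<open>The witness \<open>g\<close> lists the iterated tails of the code \<open>c\<close>,
  trading the recursion for one function quantifier.\<close>

lemma sq_graph:
  "sq c i = a \<longleftrightarrow> (\<exists>g. g 0 = c \<and> (\<forall>k. \<exists>b. g k = prod_encode (b, g (Suc k))) \<and> (\<exists>b. g i = prod_encode (a, b)))"
  (is "_ \<longleftrightarrow> (\<exists>g. ?G g)")
proof
  assume a: "sq c i = a"
  let ?g = "\<lambda>k. ((\<lambda>c. snd (prod_decode c)) ^^ k) c"
  have "sq c i = fst (prod_decode (((\<lambda>c. snd (prod_decode c)) ^^ i) c))" for c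
    by (induction i arbitrary: c) (simp_all add: funpow_Suc_right del: funpow.simps(2))
  from this[of c] have "?g i = prod_encode (a, snd (prod_decode (?g i)))"
    using a by (metis prod.collapse prod_decode_inverse)
  moreover have "\<exists>b. ?g k = prod_encode (b, ?g (Suc k))" for k
    by (rule exI[of _ "fst (prod_decode (?g k))"]) simp
  ultimately have "?G ?g" by auto
  then show "\<exists>g. ?G g" by (rule exI[of ?G ?g])
next
  assume "\<exists>g. ?G g"
  then obtain g b where g: "g 0 = c" "\<And>k. \<exists>b. g k = prod_encode (b, g (Suc k))" "g i = prod_encode (a, b)"
    by blast
  have "sq (g k) i = sq (g 0) (i + k)" for i k
  proof (induction k arbitrary: i)
    case (Suc k)
    obtain b where "g k = prod_encode (b, g (Suc k))" using g(2) by blast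
    then have "sq (g (Suc k)) i = sq (g k) (Suc i)" by simp
    then show ?case using Suc[of "Suc i"] by simp
  qed simp
  from this[of i 0] show "sq c i = a" using g by simp
qed

lemma delta_num_sq: "delta_num s \<Longrightarrow> delta_num t \<Longrightarrow> delta_num (\<lambda>F v. sq (s F v) (t F v))"
proof (rule delta_num_map2[where f = sq], rule delta_num_graph)
  show "sigma (\<lambda>F v. sq (v (Suc 0)) (v (Suc 1)) = v 0)"
    unfolding sq_graph
    by (intro sigma_ex_fun delta_sigma delta_conj delta_all delta_ex delta_eq delta_num_prod_encode
        delta_num_app delta_num_Suc delta_num_var delta_num_const)
qed

lemmas delta_intros = delta_not delta_conj delta_disj delta_imp delta_iff delta_ex delta_all delta_eq delta_less
  delta_num_if delta_num_prod_encode delta_num_sq delta_num_Suc delta_num_plus delta_num_times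
  delta_num_app delta_num_var delta_num_const

section \<open>Comparison of ranks by simulations\<close>

text \<open>
  \<open>sim r a b\<close> says that the rank of \<open>a\<close> is at most that of \<open>b\<close>, points outside the well-founded part
  having rank infinity. Being witnessed by a single relation, it is \<open>\<Sigma>\<^sup>1\<^sub>1\<close> in \<open>r\<close>.
\<close>

coinductive sim :: "('a \<Rightarrow> 'a \<Rightarrow> bool) \<Rightarrow> 'a \<Rightarrow> 'a \<Rightarrow> bool" for r where
  "(\<And>a'. r a' a \<Longrightarrow> \<exists>b'. r b' b \<and> sim r a' b') \<Longrightarrow> sim r a b"

lemma simD: "sim r a b \<Longrightarrow> r a' a \<Longrightarrow> \<exists>b'. r b' b \<and> sim r a' b'"
  by (auto elim: sim.cases)

lemma simI:
  assumes "X a b" "\<And>a b a'. X a b \<Longrightarrow> r a' a \<Longrightarrow> \<exists>b'. r b' b \<and> X a' b'"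
  shows "sim r a b"
  using assms(1)
proof (rule sim.coinduct)
  fix a b assume "X a b"
  then show "\<exists>c d. a = c \<and> b = d \<and> (\<forall>a'. r a' c \<longrightarrow> (\<exists>b'. r b' d \<and> (X a' b' \<or> sim r a' b')))"
    using assms(2)[of a b] by blast
qed

lemma sim_trans: "sim r a b \<Longrightarrow> sim r b c \<Longrightarrow> sim r a c"
proof (rule simI[of "\<lambda>a c. \<exists>b. sim r a b \<and> sim r b c"])
  fix a c a' assume "\<exists>b. sim r a b \<and> sim r b c" and "r a' a"
  then obtain b where "sim r a b" "sim r b c" by blast
  moreover obtain b' where "r b' b" "sim r a' b'" using simD[OF \<open>sim r a b\<close> \<open>r a' a\<close>] by blast
  ultimately show "\<exists>c'. r c' c \<and> (\<exists>b. sim r a' b \<and> sim r b c')" using simD[of r b c b'] by blast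
qed blast

lemma sim_accp: "Wellfounded.accp r b \<Longrightarrow> sim r a b \<Longrightarrow> Wellfounded.accp r a"
proof (induction b arbitrary: a rule: Wellfounded.accp.induct)
  case (accI b)
  show ?case by (rule Wellfounded.accp.accI) (meson accI simD)
qed

lemma not_accp_sim: "\<not> Wellfounded.accp r b \<Longrightarrow> sim r a b"
  by (rule simI[of "\<lambda>a b. \<not> Wellfounded.accp r b"]) (metis not_accp_down)+

text \<open>Failure propagates downwards: the relation that no \<open>b'\<close> below
  \<open>b\<close> simulates \<open>a\<close> is itself a simulation of \<open>b\<close> by
  \<open>a\<close>.\<close>

lemma not_sim:
  assumes "\<not> sim r a b"
  shows "\<exists>a'. r a' a \<and> sim r b a'"
proof -
  have step: "\<exists>a'. r a' a \<and> (\<forall>b'. r b' b \<longrightarrow> \<not> sim r a' b')" if "\<not> sim r a b" for a b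
    using that sim.intros[of r a b] by blast
  have "sim r b a" if "\<forall>b'. r b' b \<longrightarrow> \<not> sim r a b'" for a b
    by (rule simI[of "\<lambda>b a. \<forall>b'. r b' b \<longrightarrow> \<not> sim r a b'", OF that]) (blast dest: step)
  with step[OF assms] show ?thesis by blast
qed

lemma accp_not_sim_below: "Wellfounded.accp r a \<Longrightarrow> r b a \<Longrightarrow> \<not> sim r a b"
proof (induction a arbitrary: b rule: Wellfounded.accp.induct)
  case (accI a)
  then show ?case using simD by metis
qed

lemma sim_least: "\<exists>j. \<forall>k. sim r (t j) (t k)"
proof (cases "\<exists>j. Wellfounded.accp r (t j)")
  case True
  then obtain j0 where "Wellfounded.accp r (t j0)" ..
  \<comment> \<open>Induction on a bound \<open>a\<close> for \<open>t j\<close>: if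
    \<open>t j\<close> is not least, some \<open>t k\<close> is bounded by a point below
    \<open>t j\<close>, hence by a point below \<open>a\<close>.\<close>
  have "Wellfounded.accp r a \<Longrightarrow> sim r (t j) a \<Longrightarrow> \<exists>j. \<forall>k. sim r (t j) (t k)" for a j
  proof (induction a arbitrary: j rule: Wellfounded.accp.induct)
    case (accI a)
    show ?case
    proof (rule ccontr)
      assume "\<not> ?case"
      then obtain k where "\<not> sim r (t j) (t k)" by blast
      then obtain b where b: "r b (t j)" "sim r (t k) b" using not_sim by metis
      then obtain a' where "r a' a" "sim r b a'" using simD[OF accI.prems b(1)] by blast
      then show False using accI.IH b sim_trans \<open>\<not> ?case\<close> by metis
    qed
  qed
  moreover have "sim r (t j0) (t j0)"
    using not_sim[of r "t j0" "t j0"] accp_not_sim_below[OF \<open>Wellfounded.accp r (t j0)\<close>] by blast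
  ultimately show ?thesis using \<open>Wellfounded.accp r (t j0)\<close> by blast
qed (use not_accp_sim in metis)

lemma not_accp_iff_descending:
  "\<not> Wellfounded.accp r a \<longleftrightarrow> (\<exists>h. h 0 = a \<and> (\<forall>k::nat. r (h (Suc k)) (h k)))"
proof
  assume "\<not> Wellfounded.accp r a"
  then have "\<exists>h. \<forall>n. (\<not> Wellfounded.accp r (h n) \<and> (n = 0 \<longrightarrow> h n = a)) \<and> r (h (Suc n)) (h n)"
  proof (intro dependent_nat_choice)
    fix x and n :: nat assume "\<not> Wellfounded.accp r x \<and> (n = 0 \<longrightarrow> x = a)"
    then obtain y where "r y x" "\<not> Wellfounded.accp r y" using not_accp_down[of r x] by blast
    then show "\<exists>y. (\<not> Wellfounded.accp r y \<and> (Suc n = 0 \<longrightarrow> y = a)) \<and> r y x" by auto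
  qed blast
  then show "\<exists>h. h 0 = a \<and> (\<forall>k. r (h (Suc k)) (h k))" by blast
next
  assume "\<exists>h. h 0 = a \<and> (\<forall>k::nat. r (h (Suc k)) (h k))"
  then obtain h :: "nat \<Rightarrow> 'a" where h: "h 0 = a" "\<And>k. r (h (Suc k)) (h k)" by blast
  have "Wellfounded.accp r b \<Longrightarrow> b \<noteq> h k" for b k
  proof (induction b arbitrary: k rule: Wellfounded.accp.induct)
    case (accI b)
    then show ?case using h(2)[of k] by blast
  qed
  then show "\<not> Wellfounded.accp r a" using h(1) by blast
qed

section \<open>A uniform normal form for \<open>\<Sigma>\<^sup>1\<^sub>1\<close> predicates\<close>

abbreviation triple :: "nat \<Rightarrow> nat \<Rightarrow> nat \<Rightarrow> nat" where
  "triple a b c \<equiv> prod_encode (a, prod_encode (b, c))"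

primrec tm_code :: "tm \<Rightarrow> nat" where
  "tm_code (NVar i) = triple 0 i 0"
| "tm_code Zero = triple 1 0 0"
| "tm_code (Succ t) = triple 2 (tm_code t) 0"
| "tm_code (Plus s t) = triple 3 (tm_code s) (tm_code t)"
| "tm_code (Times s t) = triple 4 (tm_code s) (tm_code t)"
| "tm_code (App i t) = triple 5 i (tm_code t)"

primrec fm_code :: "fm \<Rightarrow> nat" where
  "fm_code (Eq s t) = triple 6 (tm_code s) (tm_code t)"
| "fm_code (Neg p) = triple 7 (fm_code p) 0"
| "fm_code (Conj p q) = triple 8 (fm_code p) (fm_code q)"
| "fm_code (ExN i p) = triple 9 i (fm_code p)"
| "fm_code (ExF i p) = triple 10 i (fm_code p)"

text \<open>
  A certificate for \<open>\<exists>G. sat G (sq c) p\<close> is a function that holds \<open>G i k\<close> at \<open>cell i k\<close>. At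
  \<open>claim e c v\<close> it holds 0 or \<open>Suc w\<close>; in the latter case it claims that the expression with code \<open>e\<close>
  has value \<open>v\<close> under the assignment \<open>sq c\<close>, and \<open>w\<close> carries the values of the subexpressions or the
  witness of a quantifier. Each condition on a certificate involves its values at two positions only.
\<close>

abbreviation cell :: "nat \<Rightarrow> nat \<Rightarrow> nat" where
  "cell i k \<equiv> triple 0 i k"

abbreviation claim :: "nat \<Rightarrow> nat \<Rightarrow> nat \<Rightarrow> nat" where
  "claim e c v \<equiv> prod_encode (1, triple e c v)"

definition clause_ok :: "nat \<Rightarrow> nat \<Rightarrow> nat \<Rightarrow> nat \<Rightarrow> nat \<Rightarrow> nat \<Rightarrow> bool" where
  "clause_ok e c v w q b \<longleftrightarrow>
    (\<forall>i j. e = triple 0 i j \<longrightarrow> v = sq c i) \<and>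
    (\<forall>i j. e = triple 1 i j \<longrightarrow> v = 0) \<and>
    (\<forall>s j. e = triple 2 s j \<longrightarrow> v = Suc w \<and> (q = claim s c w \<longrightarrow> b \<noteq> 0)) \<and>
    (\<forall>s t. e = triple 3 s t \<longrightarrow> (\<exists>y z. w = prod_encode (y, z) \<and> v = y + z \<and>
       (q = claim s c y \<or> q = claim t c z \<longrightarrow> b \<noteq> 0))) \<and>
    (\<forall>s t. e = triple 4 s t \<longrightarrow> (\<exists>y z. w = prod_encode (y, z) \<and> v = y * z \<and>
       (q = claim s c y \<or> q = claim t c z \<longrightarrow> b \<noteq> 0))) \<and>
    (\<forall>i t. e = triple 5 i t \<longrightarrow> (q = cell i w \<longrightarrow> v = b) \<and> (q = claim t c w \<longrightarrow> b \<noteq> 0)) \<and>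
    (\<forall>s t. e = triple 6 s t \<longrightarrow> (\<exists>y z. w = prod_encode (y, z) \<and> v = (if y = z then 1 else 0) \<and>
       (q = claim s c y \<or> q = claim t c z \<longrightarrow> b \<noteq> 0))) \<and>
    (\<forall>s j. e = triple 7 s j \<longrightarrow> v = (if w = 0 then 1 else 0) \<and> (q = claim s c w \<longrightarrow> b \<noteq> 0)) \<and>
    (\<forall>s t. e = triple 8 s t \<longrightarrow> (\<exists>y z. w = prod_encode (y, z) \<and>
       v = (if y = 1 \<and> z = 1 then 1 else 0) \<and>
       (q = claim s c y \<or> q = claim t c z \<longrightarrow> b \<noteq> 0))) \<and>
    (\<forall>i s. e = triple 9 i s \<longrightarrow>
       (if v = 0 then \<forall>d. (\<forall>j. j \<noteq> i \<longrightarrow> sq d j = sq c j) \<and> q = claim s d 0 \<longrightarrow> b \<noteq> 0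
        else v = 1 \<and> (\<forall>j. j \<noteq> i \<longrightarrow> sq w j = sq c j) \<and> (q = claim s w 1 \<longrightarrow> b \<noteq> 0)))"

text \<open>All free functions are read as the single \<open>x\<close>. As a condition on two
  entries, this can be tested on finite attempts.\<close>

definition certificate_ok :: "baire \<Rightarrow> nat \<Rightarrow> nat \<Rightarrow> nat \<Rightarrow> nat \<Rightarrow> nat \<Rightarrow> nat \<Rightarrow> nat \<Rightarrow> bool" where
  "certificate_ok x m e c p a q b \<longleftrightarrow>
    (p = claim e c 1 \<longrightarrow> a \<noteq> 0) \<and>
    (\<forall>i k. p = cell (i + m) k \<longrightarrow> a = x k) \<and>
    (\<forall>e' c' v w. p = claim e' c' v \<and> a = Suc w \<longrightarrow> clause_ok e' c' v w q b)"

text \<open>The components are determined by \<open>w\<close>, so the same pair serves for every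
  \<open>q\<close>.\<close>

lemma prod_encode_witness:
  assumes "\<forall>q. \<exists>y z. w = prod_encode (y, z) \<and> R y z q"
  shows "\<exists>y z. \<forall>q. R y z q"
proof -
  obtain y z where "w = prod_encode (y, z)" using assms by blast
  then have "R y z q" for q using assms[rule_format, of q] by auto
  then show ?thesis by blast
qed

text \<open>By induction on expressions, every claim made in \<open>z\<close> is true of the
  functions \<open>G\<close> read off its cells.\<close>

lemma certificate_sound:
  assumes "arithmetical_fm p"
    and z: "\<And>q q'. certificate_ok x m (fm_code p) c q (z q) q' (z q')"
  shows "\<exists>G. (\<forall>i. G (i + m) = x) \<and> sat G (sq c) p"
proof -
  define G where "G i k = z (cell i k)" for i k
  have cl: "\<exists>w. \<forall>q. clause_ok e c v w q (z q)" if "z (claim e c v) \<noteq> 0" for e c v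
    using that z[of "claim e c v"] unfolding certificate_ok_def by (metis not0_implies_Suc)
  have tm: "v = tm_val G (sq c) t" if "z (claim (tm_code t) c v) \<noteq> 0" for t c v
    using that
  proof (induction t arbitrary: v)
    case (NVar i)
    from cl[OF this] show ?case by (simp add: clause_ok_def)
  next
    case Zero
    from cl[OF this] show ?case by (simp add: clause_ok_def)
  next
    case (Succ t)
    from cl[OF Succ.prems] obtain w where "v = Suc w" "z (claim (tm_code t) c w) \<noteq> 0"
      by (auto simp: clause_ok_def)
    with Succ.IH show ?case by simp
  next
    case (Plus s t)
    from cl[OF Plus.prems] obtain w where
      "\<forall>q. \<exists>y z'. w = prod_encode (y, z') \<and> v = y + z' \<and>
       (q = claim (tm_code s) c y \<or> q = claim (tm_code t) c z' \<longrightarrow> z q \<noteq> 0)"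
      by (auto simp: clause_ok_def)
    then obtain y y' where "v = y + y'" "z (claim (tm_code s) c y) \<noteq> 0" "z (claim (tm_code t) c y') \<noteq> 0"
      by (auto dest!: prod_encode_witness)
    with Plus.IH show ?case by simp
  next
    case (Times s t)
    from cl[OF Times.prems] obtain w where
      "\<forall>q. \<exists>y z'. w = prod_encode (y, z') \<and> v = y * z' \<and>
       (q = claim (tm_code s) c y \<or> q = claim (tm_code t) c z' \<longrightarrow> z q \<noteq> 0)"
      by (auto simp: clause_ok_def)
    then obtain y y' where "v = y * y'" "z (claim (tm_code s) c y) \<noteq> 0" "z (claim (tm_code t) c y') \<noteq> 0"
      by (auto dest!: prod_encode_witness)
    with Times.IH show ?case by simp
  next
    case (App i t)
    from cl[OF App.prems] obtain w where "v = z (cell i w)" "z (claim (tm_code t) c w) \<noteq> 0"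
      by (auto simp: clause_ok_def)
    with App.IH show ?case by (simp add: G_def)
  qed
  have fm: "v = of_bool (sat G (sq c) p)" if "arithmetical_fm p" "z (claim (fm_code p) c v) \<noteq> 0" for p c v
    using that
  proof (induction p arbitrary: c v)
    case (Eq s t)
    from cl[OF Eq.prems(2)] obtain w where
      "\<forall>q. \<exists>y z'. w = prod_encode (y, z') \<and> v = (if y = z' then 1 else 0) \<and>
       (q = claim (tm_code s) c y \<or> q = claim (tm_code t) c z' \<longrightarrow> z q \<noteq> 0)"
      by (auto simp: clause_ok_def)
    then obtain y y' where "v = (if y = y' then 1 else 0)"
      "z (claim (tm_code s) c y) \<noteq> 0" "z (claim (tm_code t) c y') \<noteq> 0"
      by (auto dest!: prod_encode_witness)
    then show ?case using tm[of s c y] tm[of t c y'] by simp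
  next
    case (Neg p)
    from cl[OF Neg.prems(2)] obtain w where "v = (if w = 0 then 1 else 0)" "z (claim (fm_code p) c w) \<noteq> 0"
      by (auto simp: clause_ok_def)
    then show ?case using Neg.IH[of c w] Neg.prems(1) by (auto split: if_splits)
  next
    case (Conj p p')
    from cl[OF Conj.prems(2)] obtain w where
      "\<forall>q. \<exists>y z'. w = prod_encode (y, z') \<and> v = (if y = 1 \<and> z' = 1 then 1 else 0) \<and>
       (q = claim (fm_code p) c y \<or> q = claim (fm_code p') c z' \<longrightarrow> z q \<noteq> 0)"
      by (auto simp: clause_ok_def)
    then obtain y y' where "v = (if y = 1 \<and> y' = 1 then 1 else 0)"
      "z (claim (fm_code p) c y) \<noteq> 0" "z (claim (fm_code p') c y') \<noteq> 0"
      by (auto dest!: prod_encode_witness)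
    with Conj.IH(1)[of c y] Conj.IH(2)[of c y'] Conj.prems(1) show ?case by auto
  next
    case (ExN i p)
    from cl[OF ExN.prems(2)] obtain w where w: "\<forall>q. clause_ok (fm_code (ExN i p)) c v w q (z q)" ..
    show ?case
    proof (cases "v = 0")
      case True
      have "\<not> sat G ((sq c)(i := n)) p" for n
      proof -
        obtain d where d: "sq d = (sq c)(i := n)" using sq_update by blast
        have "z (claim (fm_code p) d 0) \<noteq> 0"
          using w True d by (simp add: clause_ok_def)
        from ExN.IH[OF _ this] ExN.prems(1) show ?thesis unfolding d[symmetric] by simp
      qed
      then show ?thesis using True by simp
    next
      case False
      with w have "v = 1" and eq: "\<forall>j. j \<noteq> i \<longrightarrow> sq w j = sq c j" and "z (claim (fm_code p) w 1) \<noteq> 0"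
        by (simp_all add: clause_ok_def)
      from ExN.IH[OF _ this(3)] ExN.prems(1) have "sat G (sq w) p"
        by (simp add: of_bool_def split: if_splits)
      also have "sq w = (sq c)(i := sq w i)" using eq by auto
      finally have "\<exists>n. sat G ((sq c)(i := n)) p" by (rule exI[of "\<lambda>n. sat G ((sq c)(i := n)) p"])
      then show ?thesis using \<open>v = 1\<close> by simp
    qed
  qed auto
  have "z (claim (fm_code p) c 1) \<noteq> 0" using z unfolding certificate_ok_def by blast
  from fm[OF assms(1) this] have "sat G (sq c) p" by (simp add: of_bool_def split: if_splits)
  moreover have "G (i + m) = x" for i
    using z unfolding certificate_ok_def G_def by blast
  ultimately show ?thesis by blast
qed

definition holds :: "(nat \<Rightarrow> baire) \<Rightarrow> nat \<Rightarrow> nat \<Rightarrow> nat \<Rightarrow> bool" where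
  "holds G e c v \<longleftrightarrow> (\<exists>t. e = tm_code t \<and> v = tm_val G (sq c) t) \<or>
     (\<exists>p. arithmetical_fm p \<and> e = fm_code p \<and> v = of_bool (sat G (sq c) p))"

text \<open>A single \<open>w\<close> must serve all \<open>q\<close> and \<open>b\<close>: it holds
  the values of the immediate subexpressions or, at a true existential, the code of an assignment
  satisfying the body.\<close>

lemma holds_witness:
  assumes "holds G e c v"
  shows "\<exists>w. \<forall>q b. (\<forall>e c v. q = claim e c v \<and> holds G e c v \<longrightarrow> b \<noteq> 0) \<and>
           (\<forall>i k. q = cell i k \<longrightarrow> b = G i k) \<longrightarrow> clause_ok e c v w q b"
proof -
  have tm: "holds G (tm_code t) c (tm_val G (sq c) t)" for t c
    unfolding holds_def by blast
  have fm: "holds G (fm_code p) c (of_bool (sat G (sq c) p))" if "arithmetical_fm p" for p c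
    unfolding holds_def using that by blast
  consider t where "e = tm_code t" "v = tm_val G (sq c) t"
    | p where "arithmetical_fm p" "e = fm_code p" "v = of_bool (sat G (sq c) p)"
    using assms unfolding holds_def by blast
  then show ?thesis
  proof cases
    case 1
    show ?thesis
    proof (cases t)
      case (Succ s)
      then show ?thesis using 1 tm[of s c]
        by (intro exI[of _ "tm_val G (sq c) s"]) (simp add: clause_ok_def)
    next
      case (Plus s s')
      then show ?thesis using 1 tm[of s c] tm[of s' c]
        by (intro exI[of _ "prod_encode (tm_val G (sq c) s, tm_val G (sq c) s')"]) (auto simp: clause_ok_def)
    next
      case (Times s s')
      then show ?thesis using 1 tm[of s c] tm[of s' c]
        by (intro exI[of _ "prod_encode (tm_val G (sq c) s, tm_val G (sq c) s')"]) (auto simp: clause_ok_def)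
    next
      case (App i s)
      then show ?thesis using 1 tm[of s c]
        by (intro exI[of _ "tm_val G (sq c) s"]) (simp add: clause_ok_def)
    qed (use 1 in \<open>simp_all add: clause_ok_def\<close>)
  next
    case 2
    show ?thesis
    proof (cases p)
      case (Eq s s')
      then show ?thesis using 2 tm[of s c] tm[of s' c]
        by (intro exI[of _ "prod_encode (tm_val G (sq c) s, tm_val G (sq c) s')"]) (auto simp: clause_ok_def)
    next
      case (Neg p1)
      then show ?thesis using 2 fm[of p1 c]
        by (intro exI[of _ "of_bool (sat G (sq c) p1)"]) (auto simp: clause_ok_def)
    next
      case (Conj p1 p2)
      then show ?thesis using 2 fm[of p1 c] fm[of p2 c]
        by (intro exI[of _ "prod_encode (of_bool (sat G (sq c) p1), of_bool (sat G (sq c) p2))"])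
           (auto simp: clause_ok_def)
    next
      case (ExN i p1)
      show ?thesis
      proof (cases "sat G (sq c) p")
        case True
        then obtain n where n: "sat G ((sq c)(i := n)) p1" using ExN by auto
        obtain d where d: "sq d = (sq c)(i := n)" using sq_update by blast
        show ?thesis using 2 ExN True n fm[of p1 d] d
          by (intro exI[of _ d]) (simp add: clause_ok_def)
      next
        case False
        have "\<not> sat G (sq d) p1" if "\<forall>j. j \<noteq> i \<longrightarrow> sq d j = sq c j" for d
        proof -
          have "sq d = (sq c)(i := sq d i)" using that by auto
          then show ?thesis using False ExN by (metis sat.simps(4))
        qed
        then have "holds G (fm_code p1) d 0" if "\<forall>j. j \<noteq> i \<longrightarrow> sq d j = sq c j" for d
          using that fm[of p1 d] 2 ExN by fastforce
        then show ?thesis using 2 ExN False by (auto simp: clause_ok_def)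
      qed
    qed (use 2 in simp_all)
  qed
qed

lemma certificate_complete:
  assumes "arithmetical_fm p" "\<And>i. G (i + m) = x" "sat G (sq c) p"
  shows "\<exists>z. \<forall>q q'. certificate_ok x m (fm_code p) c q (z q) q' (z q')"
proof -
  obtain wit where wit: "\<And>e c v q b. holds G e c v \<Longrightarrow>
      (\<And>e c v. q = claim e c v \<Longrightarrow> holds G e c v \<Longrightarrow> b \<noteq> 0) \<Longrightarrow>
      (\<And>i k. q = cell i k \<Longrightarrow> b = G i k) \<Longrightarrow> clause_ok e c v (wit e c v) q b"
    using holds_witness[of G] by metis
  \<comment> \<open>At claim positions this certificate asserts exactly what is true.\<close>
  define z where "z q = (case prod_decode q of (k, r) \<Rightarrow> case prod_decode r of (e, s) \<Rightarrow>
      if k = 0 then G e s else case prod_decode s of (c, v) \<Rightarrow>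
      if holds G e c v then Suc (wit e c v) else 0)" for q
  have cell: "z (cell i k) = G i k" for i k by (simp add: z_def)
  have claim: "z (claim e c v) = (if holds G e c v then Suc (wit e c v) else 0)" for e c v
    by (simp add: z_def)
  have "holds G (fm_code p) c 1" using assms(1,3) unfolding holds_def by auto
  then have "certificate_ok x m (fm_code p) c q (z q) q' (z q')" for q q'
    unfolding certificate_ok_def
  proof (intro conjI allI impI)
    fix e' c' v w assume "q = claim e' c' v \<and> z q = Suc w"
    then have "(if holds G e' c' v then Suc (wit e' c' v) else 0) = Suc w" using claim by metis
    then have "holds G e' c' v" "w = wit e' c' v" by (simp_all split: if_splits)
    moreover have "z q' \<noteq> 0" if "q' = claim e c v" "holds G e c v" for e c v
      unfolding that(1) claim using that(2) by simp
    ultimately show "clause_ok e' c' v w q' (z q')" using wit[of e' c' v q' "z q'"] cell by blast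
  next
    assume "holds G (fm_code p) c 1" "q = claim (fm_code p) c 1"
    then show "z q \<noteq> 0" unfolding \<open>q = _\<close> claim by simp
  qed (simp add: cell assms(2))
  then show ?thesis by blast
qed

text \<open>
  The tree of finite attempts \<open>s\<close>, of length \<open>l\<close>, at a certificate for the formula with code \<open>e\<close>, whose
  first \<open>m\<close> functions are quantified and whose other functions are \<open>x\<close>. All parameters are part of
  the nodes, so that the trees for different formulas can be compared within one relation.
\<close>

definition below :: "baire \<Rightarrow> nat \<Rightarrow> nat \<Rightarrow> bool" where
  "below x u' u \<longleftrightarrow> (\<exists>m e c l s s'.
     u = prod_encode (prod_encode (prod_encode (m, e), c), prod_encode (l, s)) \<and>
     u' = prod_encode (prod_encode (prod_encode (m, e), c), prod_encode (Suc l, s')) \<and>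
     (\<forall>i. i < l \<longrightarrow> sq s' i = sq s i) \<and>
     (\<forall>p q. p < Suc l \<and> q < Suc l \<longrightarrow> certificate_ok x m e c p (sq s' p) q (sq s' q)))"

lemma delta_below: "delta_fun x \<Longrightarrow> delta_num s \<Longrightarrow> delta_num t \<Longrightarrow> delta (\<lambda>F v. below (x F v) (s F v) (t F v))"
proof (rule delta_subst2[where R = below])
  show "delta (\<lambda>F v. below (F 0) (v 0) (v 1))"
    unfolding below_def certificate_ok_def clause_ok_def if_bool_eq_conj
    by (intro delta_intros)
qed

abbreviation root :: "nat \<Rightarrow> nat \<Rightarrow> nat" where
  "root d c \<equiv> prod_encode (prod_encode (d, c), prod_encode (0, 0))"

text \<open>Attempts along a descending sequence cohere, and each test on their limit
  \<open>z\<close> already occurs at a finite stage; conversely the initial segments of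
  \<open>z\<close> descend.\<close>

lemma not_accp_root:
  "\<not> Wellfounded.accp (below x) (root (prod_encode (m, e)) c) \<longleftrightarrow>
     (\<exists>z. \<forall>p q. certificate_ok x m e c p (z p) q (z q))"
  (is "?l \<longleftrightarrow> ?r")
proof
  assume ?l
  then obtain h where h: "h 0 = root (prod_encode (m, e)) c" "\<And>k. below x (h (Suc k)) (h k)"
    unfolding not_accp_iff_descending by blast
  let ?u = "\<lambda>l s. prod_encode (prod_encode (prod_encode (m, e), c), prod_encode (l, s))"
  have "\<exists>s. h l = ?u l s" for l
  proof (induction l)
    case (Suc l)
    then obtain s where "h l = ?u l s" ..
    with h(2)[of l] show ?case unfolding below_def by auto
  qed (use h(1) in blast)
  then obtain s where s: "\<And>l. h l = ?u l (s l)" by metis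
  have step: "(\<forall>i. i < l \<longrightarrow> sq (s (Suc l)) i = sq (s l) i) \<and>
     (\<forall>p q. p < Suc l \<and> q < Suc l \<longrightarrow> certificate_ok x m e c p (sq (s (Suc l)) p) q (sq (s (Suc l)) q))" for l
    using h(2)[of l] unfolding s below_def by auto
  have stable: "sq (s (Suc l + k)) i = sq (s (Suc l)) i" if "i \<le> l" for i l k
    by (induction k) (use step that in auto)
  define z where "z i = sq (s (Suc i)) i" for i
  have z: "sq (s (Suc l)) i = z i" if "i \<le> l" for i l
    using stable[of i i "l - i"] that by (simp add: z_def)
  have "certificate_ok x m e c p (z p) q (z q)" for p q
    using step[of "max p q", THEN conjunct2, rule_format, of p q] z[of p "max p q"] z[of q "max p q"]
    by (simp add: less_Suc_eq_le)
  then show ?r by blast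
next
  assume ?r
  then obtain z where z: "\<And>p q. certificate_ok x m e c p (z p) q (z q)" by blast
  obtain s where s: "\<And>l i. i < l \<Longrightarrow> sq (s l) i = z i" using sq_initial_segment[of _ z] by metis
  \<comment> \<open>The root carries the code 0, from which the chosen \<open>s 0\<close> may
    differ.\<close>
  let ?s = "\<lambda>l. if l = 0 then 0 else s l"
  have "below x (prod_encode (prod_encode (prod_encode (m, e), c), prod_encode (Suc l, ?s (Suc l))))
    (prod_encode (prod_encode (prod_encode (m, e), c), prod_encode (l, ?s l)))" for l
    unfolding below_def using z s by (auto simp: s)
  then show ?l unfolding not_accp_iff_descending
    by (intro exI[of _ "\<lambda>l. prod_encode (prod_encode (prod_encode (m, e), c), prod_encode (l, ?s l))"])
       (simp add: prod_encode_def)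
qed

text \<open>The index \<open>d\<close> packs the number of quantified functions with the code of the
  matrix. One relation contains the trees for all \<open>d\<close> and \<open>c\<close>, which
  permits both diagonalisation and comparison of ranks.\<close>

lemma sigma_normal_form:
  assumes "sigma P"
  shows "\<exists>d. \<forall>x c. P (\<lambda>_. x) (sq c) \<longleftrightarrow> \<not> Wellfounded.accp (below x) (root d c)"
proof -
  obtain A m where A: "arith A" "\<And>F v. P F v \<longleftrightarrow> (\<exists>G. (\<forall>i. G (i + m) = F i) \<and> A G v)"
    using assms unfolding sigma_def by blast
  obtain p where p: "arithmetical_fm p" "\<And>F v. A F v \<longleftrightarrow> sat F v p"
    using A(1) by (auto simp: arith_def)
  have "P (\<lambda>_. x) (sq c) \<longleftrightarrow> \<not> Wellfounded.accp (below x) (root (prod_encode (m, fm_code p)) c)" for x c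
    unfolding A(2) p(2) not_accp_root
    using certificate_sound[OF p(1)] certificate_complete[OF p(1)] by metis
  then show ?thesis by blast
qed

lemma delta_fun_var: "delta_fun (\<lambda>F v. F i)"
  by (intro delta_funI delta_num_app delta_num_var)

lemma sim_iff_witness:
  "sim r a b \<longleftrightarrow> (\<exists>Z :: baire. Z (prod_encode (a, b)) \<noteq> 0 \<and>
     (\<forall>a b a'. Z (prod_encode (a, b)) \<noteq> 0 \<and> r a' a \<longrightarrow>
       (\<exists>b'. r b' b \<and> Z (prod_encode (a', b')) \<noteq> 0)))" (is "_ \<longleftrightarrow> (\<exists>Z. ?P Z)")
proof
  assume "sim r a b"
  let ?Z = "\<lambda>q. of_bool (sim r (fst (prod_decode q)) (snd (prod_decode q)))"
  have "?P ?Z" using \<open>sim r a b\<close> by (auto dest: simD)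
  then show "\<exists>Z. ?P Z" by (rule exI[of ?P ?Z])
next
  assume "\<exists>Z. ?P Z"
  then obtain Z :: baire where Z: "?P Z" by blast
  show "sim r a b"
    by (rule simI[of "\<lambda>a b. Z (prod_encode (a, b)) \<noteq> 0"]) (use Z in blast)+
qed

lemma sigma_sim:
  "delta_fun x \<Longrightarrow> delta_num s \<Longrightarrow> delta_num t \<Longrightarrow>
    sigma (\<lambda>F v. sim (below (x F v)) (s F v) (t F v))"
proof (rule sigma_subst2[where R = "\<lambda>x. sim (below x)"])
  show "sigma (\<lambda>F v. sim (below (F 0)) (v 0) (v 1))"
    unfolding sim_iff_witness
    by (intro sigma_ex_fun delta_sigma delta_intros delta_below delta_fun_var)
qed

section \<open>Two incomparable sets\<close>

text \<open>A branch lists its nodes from the root on, so membership is one universal number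
  quantifier over \<open>below\<close>, uniformly \<open>\<Delta>\<^sup>1\<^sub>1\<close> in both
  indices.\<close>

definition branches :: "nat \<Rightarrow> nat \<Rightarrow> baire set" where
  "branches d c = {h. h 0 = root d c \<and> (\<forall>k. below (\<lambda>_. 0) (h (Suc k)) (h k))}"

lemma branches_nonempty: "branches d c \<noteq> {} \<longleftrightarrow> \<not> Wellfounded.accp (below (\<lambda>_. 0)) (root d c)"
  by (auto simp: branches_def not_accp_iff_descending)

lemma delta_branches:
  assumes "delta_num s" "delta_num t"
  shows "delta (\<lambda>F v. F i \<in> branches (s F v) (t F v))"
  unfolding branches_def mem_Collect_eq
  by (intro delta_intros delta_below delta_funI assms)

abbreviation pair :: "nat \<Rightarrow> nat \<Rightarrow> nat" where
  "pair i j \<equiv> triple i j 0"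

text \<open>
  A \<open>\<Pi>\<^sup>1\<^sub>1\<close> substitute for the existence of a Hyp function from \<open>branches d c\<close> to \<open>branches d' c'\<close>. If
  \<open>e\<close> defines \<open>f x i \<noteq> j\<close>, then \<open>j = f x i\<close> is the only \<open>j\<close> whose tree is well-founded, hence the one
  of least rank. For arbitrary \<open>e\<close> some \<open>y\<close> of pointwise least rank still exists.
\<close>

definition maps_into :: "nat \<Rightarrow> nat \<Rightarrow> nat \<Rightarrow> nat \<Rightarrow> bool" where
  "maps_into d c d' c' \<longleftrightarrow> (\<exists>e. \<forall>x. x \<in> branches d c \<longrightarrow> (\<forall>y.
     (\<forall>i j. sim (below x) (root e (pair i (y i))) (root e (pair i j))) \<longrightarrow> y \<in> branches d' c'))"

text \<open>For a fixed \<open>x\<close>, \<open>sim_least\<close> yields some \<open>y\<close> of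
  pointwise least rank, which must lie in the target.\<close>

lemma maps_into_nonempty:
  assumes "maps_into d c d' c'" "branches d c \<noteq> {}"
  shows "branches d' c' \<noteq> {}"
proof -
  obtain e x where "\<And>y. (\<And>i j. sim (below x) (root e (pair i (y i))) (root e (pair i j))) \<Longrightarrow> y \<in> branches d' c'"
    using assms unfolding maps_into_def by blast
  moreover obtain y where "\<And>i j. sim (below x) (root e (pair i (y i))) (root e (pair i j))"
    using sim_least[of "below x" "\<lambda>j. root e (pair _ j)"] by metis
  ultimately show ?thesis by blast
qed

text \<open>After negation the simulations occur positively, and both membership statements are
  \<open>\<Delta>\<^sup>1\<^sub>1\<close>. Both trees take the pair of indices as input, in
  preparation for self-reference.\<close>

lemma sigma_not_maps_into:
  "sigma (\<lambda>F v. \<not> maps_into (v i) (pair (v 0) (v 1)) (v j) (pair (v 0) (v 1)))"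
  unfolding maps_into_def not_ex not_all not_imp
  by (intro sigma_all sigma_ex_fun sigma_conj sigma_sim delta_sigma[OF delta_not] delta_sigma[OF delta_branches]
      delta_branches delta_fun_var delta_intros)

section \<open>Hyp relations and functions in semantic form\<close>

lemma Sigma11_sigma:
  assumes "Sigma11 A"
  shows "sigma (\<lambda>F v. (F 0, F 1) \<in> A)"
proof -
  obtain p where p: "Sigma11_fm p" "A = defined_rel p" using assms unfolding Sigma11_def by blast
  have "sigma (\<lambda>F v. sat F (\<lambda>_. 0) p)"
    using sigma_subst_num[of "\<lambda>F v n. sat F (\<lambda>_. n) p", OF sigma_num_rename[OF sigma_sat[OF p(1)]] delta_num_const] .
  \<comment> \<open>All function variables other than 0 and 1 read \<open>F 0\<close>, for which the
    zero function is substituted next.\<close>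
  then have *: "sigma (\<lambda>F v. sat (\<lambda>i. F (if i = 0 then 1 else if i = 1 then 2 else 0)) (\<lambda>_. 0) p)"
    by (rule sigma_fun_rename)
  have "sigma (\<lambda>F v. sat (\<lambda>i. if i = 0 then F 0 else if i = 1 then F 1 else (\<lambda>_. 0)) (\<lambda>_. 0) p)"
  proof (rule sigma_subst_fun[of "\<lambda>F v h. sat (\<lambda>i. if i = 0 then F 0 else if i = 1 then F 1 else h) (\<lambda>_. 0) p"])
    have eq: "(\<lambda>i. F (if i = 0 then 1 else if i = 1 then 2 else 0)) =
        (\<lambda>i. if i = 0 then F (Suc 0) else if i = 1 then F (Suc 1) else F 0)" for F :: "nat \<Rightarrow> baire"
      by (auto simp: numeral_2_eq_2)
    show "sigma (\<lambda>F v. sat (\<lambda>i. if i = 0 then F (Suc 0) else if i = 1 then F (Suc 1) else F 0) (\<lambda>_. 0) p)"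
      using * unfolding eq .
    show "delta_fun (\<lambda>F v _. 0)" by (intro delta_funI delta_num_const)
  qed
  moreover have "(\<lambda>i::nat. if i = 0 then x else if i = 1 then y else (\<lambda>_. 0)) = (\<lambda>_ _. 0)(0 := x, 1 := y)"
    for x y :: baire by auto
  ultimately show ?thesis unfolding p(2) defined_rel_def by simp
qed

lemma sigma_Sigma11:
  assumes "sigma (\<lambda>F v. R (F 0) (F 1))"
  shows "Sigma11 {(x, y). R x y}"
proof -
  obtain p where p: "Sigma11_fm p" "\<And>F v. sat F v p \<longleftrightarrow> R (F 0) (F 1)"
    using sigma_fm[OF assms] by blast
  then show ?thesis unfolding Sigma11_def defined_rel_def by auto
qed

lemma delta_Hyp: "delta (\<lambda>F v. R (F 0) (F 1)) \<Longrightarrow> Hyp {(x, y). R x y}"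
  using sigma_Sigma11[of R] sigma_Sigma11[of "\<lambda>x y. \<not> R x y"]
  by (simp add: Hyp_def Pi11_def delta_def Compl_eq case_prod_unfold)

lemma delta_num_Hyp_fun: "delta_num (\<lambda>F v. f (F 0) (v 0)) \<Longrightarrow> Hyp_fun f"
  unfolding Hyp_fun_def fun_eq_iff
  by (intro delta_Hyp delta_all delta_eq delta_num_app delta_num_var)

lemma Hyp_fun_delta_num:
  assumes "Hyp_fun f"
  shows "delta_num (\<lambda>F v. f (F 0) (v 0))"
proof -
  have "sigma (\<lambda>F v. f (F 0) = F 1)"
    using Sigma11_sigma[of "{(x, y). f x = y}"] assms unfolding Hyp_fun_def Hyp_def by simp
  from sigma_fun_rename[OF this, of "\<lambda>i. if i = 0 then 1 else 0"]
  have "sigma (\<lambda>F v. f (F (Suc 0)) = F 0)" by simp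
  then have "sigma (\<lambda>F v. \<exists>y. f (F 0) = y \<and> y (v 1) = v 0)"
    by (intro sigma_ex_fun sigma_conj delta_sigma[OF delta_eq] delta_num_app delta_num_var)
  then show ?thesis unfolding delta_num_def by simp
qed

text \<open>In the normal form of \<open>f x i \<noteq> j\<close> the tree is well-founded exactly
  at the value of \<open>f x i\<close>. A least \<open>y i\<close> is bounded by that tree, so its
  own is well-founded and \<open>y\<close> is \<open>f x\<close>.\<close>

lemma Hyp_fun_maps_into:
  assumes "Hyp_fun f" "f ` branches d c \<subseteq> branches d' c'"
  shows "maps_into d c d' c'"
proof -
  have "sigma (\<lambda>F v. f (F 0) (v 0) \<noteq> v 1)"
    using Hyp_fun_delta_num[OF assms(1)] by (intro delta_sigma delta_not delta_eq delta_num_var)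
  from sigma_normal_form[OF this] obtain e where
    e: "\<And>x c. f x (sq c 0) \<noteq> sq c 1 \<longleftrightarrow> \<not> Wellfounded.accp (below x) (root e c)" by blast
  have e': "Wellfounded.accp (below x) (root e (pair i j)) \<longleftrightarrow> f x i = j" for x i j
    using e[of x "pair i j"] by auto
  have "y = f x" if "\<And>i j. sim (below x) (root e (pair i (y i))) (root e (pair i j))" for x y
  proof
    fix i
    have "Wellfounded.accp (below x) (root e (pair i (y i)))"
      by (rule sim_accp[OF _ that[of i "f x i"]]) (simp add: e')
    then show "y i = f x i" by (simp add: e')
  qed
  then show ?thesis using assms(2) unfolding maps_into_def by blast
qed

text \<open>
  The Rosser-style diagonalisation: \<open>branches d c\<close> is nonempty iff \<open>p\<close> has rank at most that of \<open>q\<close>, and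
  \<open>branches d' c\<close> is nonempty iff \<open>q\<close> has rank less than \<open>p\<close> or both have rank infinity, where \<open>p\<close>
  and \<open>q\<close> rank the two possible maps and \<open>c\<close> codes the pair of \<open>d\<close> and \<open>d'\<close>.
\<close>

lemma incomparable_branches:
  "\<exists>d d' c. branches d c \<noteq> {} \<and> branches d' c \<noteq> {} \<and> \<not> maps_into d c d' c \<and> \<not> maps_into d' c d c"
proof -
  let ?r = "below (\<lambda>_. 0)"
  let ?wf = "Wellfounded.accp ?r"
  obtain p where p: "\<And>d d'. maps_into d (pair d d') d' (pair d d') \<longleftrightarrow> ?wf (root p (pair d d'))"
  proof -
    from sigma_normal_form[OF sigma_not_maps_into[of 0 1]] obtain p where
      "\<And>c. \<not> maps_into (sq c 0) (pair (sq c 0) (sq c 1)) (sq c 1) (pair (sq c 0) (sq c 1)) \<longleftrightarrow> \<not> ?wf (root p c)"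
      by blast
    from this[of "pair _ _"] show thesis by (intro that[of p]) simp
  qed
  obtain q where q: "\<And>d d'. maps_into d' (pair d d') d (pair d d') \<longleftrightarrow> ?wf (root q (pair d d'))"
  proof -
    from sigma_normal_form[OF sigma_not_maps_into[of 1 0]] obtain q where
      "\<And>c. \<not> maps_into (sq c 1) (pair (sq c 0) (sq c 1)) (sq c 0) (pair (sq c 0) (sq c 1)) \<longleftrightarrow> \<not> ?wf (root q c)"
      by blast
    from this[of "pair _ _"] show thesis by (intro that[of q]) simp
  qed
  have zero: "delta_fun (\<lambda>F v _. 0)" by (intro delta_funI delta_num_const)
  have "sigma (\<lambda>F v. sim ?r (root p (pair (v 0) (v 1))) (root q (pair (v 0) (v 1))))"
    by (intro sigma_sim zero delta_intros)
  from sigma_normal_form[OF this] obtain d where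
    "\<And>c. sim ?r (root p (pair (sq c 0) (sq c 1))) (root q (pair (sq c 0) (sq c 1))) \<longleftrightarrow> \<not> ?wf (root d c)"
    by blast
  from this[of "pair _ _"] have d: "\<And>e d'. branches d (pair e d') \<noteq> {} \<longleftrightarrow>
    sim ?r (root p (pair e d')) (root q (pair e d'))"
    by (simp add: branches_nonempty)
  \<comment> \<open>Strict comparison: a child of the root for \<open>p\<close> bounds the rank of
    \<open>q\<close>. Two ill-founded trees satisfy this as well.\<close>
  have "sigma (\<lambda>F v. \<exists>u. ?r u (root p (pair (v 0) (v 1))) \<and> sim ?r (root q (pair (v 0) (v 1))) u)"
    by (intro sigma_ex sigma_conj delta_sigma[OF delta_below] sigma_sim zero delta_intros)
  from sigma_normal_form[OF this] obtain d' where
    "\<And>c. (\<exists>u. ?r u (root p (pair (sq c 0) (sq c 1))) \<and> sim ?r (root q (pair (sq c 0) (sq c 1))) u)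
      \<longleftrightarrow> \<not> ?wf (root d' c)"
    by blast
  from this[of "pair _ _"] have d': "\<And>d e. branches d' (pair d e) \<noteq> {} \<longleftrightarrow>
    (\<exists>u. ?r u (root p (pair d e)) \<and> sim ?r (root q (pair d e)) u)"
    by (simp add: branches_nonempty)
  \<comment> \<open>The input now codes the very indices \<open>d\<close> and \<open>d'\<close>,
    which closes the self-reference.\<close>
  define c where "c = pair d d'"
  note p = p[of d d', folded c_def] and q = q[of d' d, folded c_def]
    and d = d[of d d', folded c_def] and d' = d'[of d d', folded c_def]
  have "\<not> ?wf (root p c)"
  proof
    assume wf: "?wf (root p c)"
    with p have into: "maps_into d c d' c" by simp
    show False
    proof (cases "branches d c = {}")
      \<comment> \<open>Both sets would be nonempty, so \<open>p\<close> would have rank at most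
        that of \<open>q\<close>, which is less than that of \<open>p\<close>.\<close>
      case False
      with maps_into_nonempty[OF into] have "branches d' c \<noteq> {}" .
      then obtain u where u: "?r u (root p c)" "sim ?r (root q c) u" using d' by blast
      moreover have "sim ?r (root p c) (root q c)" using False d by blast
      ultimately show False using sim_trans[of ?r "root p c" "root q c" u] accp_not_sim_below[OF wf u(1)] by blast
    next
      \<comment> \<open>Here \<open>q\<close> has smaller rank than \<open>p\<close>, so it is
        well-founded and gives a map from a nonempty set into the empty one.\<close>
      case True
      then obtain u where u: "?r u (root p c)" "sim ?r (root q c) u"
        using d not_sim[of ?r "root p c" "root q c"] by blast
      then have "branches d' c \<noteq> {}" using d' by blast
      moreover have "maps_into d' c d c"
        using q sim_accp[OF Wellfounded.accp_downward[OF wf u(1)] u(2)] by simp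
      ultimately show False using maps_into_nonempty True by blast
    qed
  qed
  moreover have wf_q: "\<not> ?wf (root q c)"
  proof
    assume wf: "?wf (root q c)"
    \<comment> \<open>An ill-founded child of \<open>p\<close> bounds every rank, so the second set
      is nonempty. The map given by \<open>q\<close> then makes the first nonempty, bounding the
      ill-founded \<open>p\<close> by the well-founded \<open>q\<close>.\<close>
    obtain u where "?r u (root p c)" "\<not> ?wf u"
      using not_accp_down[OF \<open>\<not> ?wf (root p c)\<close>] by blast
    then have "branches d' c \<noteq> {}" using d' not_accp_sim[of ?r u] by blast
    moreover have "maps_into d' c d c" using wf q by simp
    ultimately have "sim ?r (root p c) (root q c)" using d maps_into_nonempty by simp
    then show False using sim_accp[OF wf] \<open>\<not> ?wf (root p c)\<close> by blast
  qed
  moreover have "branches d c \<noteq> {}" using d not_accp_sim[OF wf_q] by blast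
  moreover obtain u where "?r u (root p c)" "\<not> ?wf u"
    using not_accp_down[OF \<open>\<not> ?wf (root p c)\<close>] by blast
  then have "branches d' c \<noteq> {}" using d' not_accp_sim[of ?r u] by blast
  ultimately show ?thesis using p q by blast
qed

section \<open>From sets to equivalence relations with at most two classes\<close>

definition split_rel :: "baire set \<Rightarrow> (baire \<times> baire) set" where
  "split_rel A = {(x, y). x \<in> A \<longleftrightarrow> y \<in> A}"

lemma equiv_split_rel: "equiv UNIV (split_rel A)"
  by (rule equivI) (auto simp: split_rel_def intro: refl_onI symI transI)

lemma Hyp_split_rel_branches: "Hyp (split_rel (branches d c))"
  unfolding split_rel_def
  by (intro delta_Hyp delta_iff delta_branches delta_num_const)

lemma eq1_reducible_split_rel: "eq1 \<le>\<^sub>H split_rel A"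
  unfolding Hyp_reducible_def eq1_def split_rel_def
  by (intro exI[of _ "\<lambda>_ _. 0"] conjI delta_num_Hyp_fun delta_num_const) simp

lemma split_rel_branches_reducible_eq2: "split_rel (branches d c) \<le>\<^sub>H eq2"
  unfolding Hyp_reducible_def
  by (intro exI[of _ "\<lambda>x _. if x \<in> branches d c then 0 else 1"] conjI delta_num_Hyp_fun
      delta_num_if delta_branches delta_num_const) (auto simp: split_rel_def eq2_def)

lemma Hyp_fun_const: "Hyp_fun f \<Longrightarrow> Hyp_fun (\<lambda>_. f (\<lambda>_. 0))"
proof (rule delta_num_Hyp_fun)
  assume "Hyp_fun f"
  then have "sigma (\<lambda>F v. f (F 0) (v (Suc 0)) = v 0)"
    using Hyp_fun_delta_num unfolding delta_num_def by simp
  note * = this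
  show "delta_num (\<lambda>F v. f (\<lambda>_. 0) (v 0))"
    unfolding delta_num_def
  proof (rule sigma_subst_fun[of "\<lambda>F v h. f h (v (Suc 0)) = v 0", rotated])
    show "delta_fun (\<lambda>F v _. 0)" by (intro delta_funI delta_num_const)
  qed (rule *)
qed

text \<open>The constant zero map forces the zero function out of \<open>A\<close>. If
  \<open>f\<close> sends it into \<open>B\<close>, the constant map with that value works; otherwise
  \<open>f\<close> sends the points of \<open>A\<close>, being inequivalent to it, into
  \<open>B\<close>.\<close>

lemma split_rel_reducible_imp_map:
  assumes red: "split_rel A \<le>\<^sub>H split_rel B" and ne: "A \<noteq> {}" "B \<noteq> {}"
    and BA: "\<And>f. Hyp_fun f \<Longrightarrow> \<not> f ` B \<subseteq> A"
  shows "\<exists>f. Hyp_fun f \<and> f ` A \<subseteq> B"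
proof -
  obtain f where f: "Hyp_fun f" "\<And>x y. (x \<in> A \<longleftrightarrow> y \<in> A) \<longleftrightarrow> (f x \<in> B \<longleftrightarrow> f y \<in> B)"
    using red unfolding Hyp_reducible_def split_rel_def by auto
  have "Hyp_fun (\<lambda>_ _. 0)" by (intro delta_num_Hyp_fun delta_num_const)
  then have "(\<lambda>_. 0) \<notin> A" using BA[of "\<lambda>_ _. 0"] by auto
  then show ?thesis
    using f Hyp_fun_const[OF f(1)] by (cases "f (\<lambda>_. 0) \<in> B") (blast, metis image_subsetI)
qed

theorem theorem4p8:
  "\<exists>E F :: (baire \<times> baire) set.
     equiv UNIV E \<and> Hyp E \<and> eq1 \<le>\<^sub>H E \<and> E \<le>\<^sub>H eq2 \<and>
     equiv UNIV F \<and> Hyp F \<and> eq1 \<le>\<^sub>H F \<and> F \<le>\<^sub>H eq2 \<and>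
     \<not> E \<le>\<^sub>H F \<and> \<not> F \<le>\<^sub>H E"
proof -
  obtain d d' c where ne: "branches d c \<noteq> {}" "branches d' c \<noteq> {}"
    and no: "\<not> maps_into d c d' c" "\<not> maps_into d' c d c"
    using incomparable_branches by blast
  then have "\<not> split_rel (branches d c) \<le>\<^sub>H split_rel (branches d' c)"
    "\<not> split_rel (branches d' c) \<le>\<^sub>H split_rel (branches d c)"
    using split_rel_reducible_imp_map Hyp_fun_maps_into by metis+
  then show ?thesis
    using equiv_split_rel Hyp_split_rel_branches eq1_reducible_split_rel split_rel_branches_reducible_eq2
    by blast
qed

end
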